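(* Let $N\ge0$ be an integer and let $a,b,d,e,\mu$ be nonzero complex numbers. Put $$U_n(x)=\frac{(aq,\frac{2aqx}{bd})_n}{(\frac{aq}{d},\frac{2aqx}{b})_n}\;{}_4\phi_3\Bigl({\frac{b^2\mu de}{a^2q}q^{-n},\,d,\,\frac{b}{2x},\,q^{-n}\atop\frac{b^2\mu de}{a}q^{N-n},\,q^{-N},\,\frac{bd}{2ax}q^{-n}};q\Bigr),$$ $$V_m(x)={}_4\phi_3\Bigl({\frac{b}{2x},\,\frac{q^{-N+1}}{d},\,\frac{a^2q^{1-N+m}}{b^2\mu de},\,q^{-m}\atop\frac{aq^{-N+2}}{2\mu bdex},\,\frac{aq}{d},\,q^{-N}};q\Bigr).$$ Then, for $0\le n,m\le N$, $$\sum_{k=0}^NU_n(x_k)V_m(x_k)\,r_k=C_n\,\delta_{n,m},$$ where $x_k=\frac12bq^k$, $$r_k=\frac{(\frac{aq}{d},q^{-N},\frac{\mu b^2de}{aq}q^N)_k}{(aq,\frac{\mu b^2e}{a},q)_k}\,q^k\,\Bigl(\frac{d}{aq}\Bigr)^N\frac{(aq,\frac{\mu b^2e}{a})_N}{(d,\frac{\mu b^2de}{a^2q})_N},$$ $$C_n=\Bigl(\frac{q^{-N}}{d}\Bigr)^n\frac{\bigl(q,\frac{aq^{1-N}}{\mu b^2e},\frac{a^2q^2}{\mu b^2de},aq\bigr)_n}{\bigl(q^{-N},\frac{aq^{1-N}}{\mu b^2de},\frac{aq}{d},\frac{a^2q^{2-N}}{\mu b^2de}\bigr)_n}\;\frac{1-\frac{a^2q^{1-N+n}}{\mu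 b^2de}}{1-\frac{a^2q^{1-N+2n}}{\mu b^2de}} .$$
   Context: Throughout $q\in\mathbb C$, $0<|q|<1$; $(x)_0=1$, $(x)_k=\prod_{j=0}^{k-1}(1-xq^j)$, $(x_1,\dots,x_r)_k=\prod_i (x_i)_k$. The parameter $e$ is a complex number (not Euler's number). $${}_4\phi_3\Bigl({\alpha_1,\alpha_2,\alpha_3,q^{-n}\atop\beta_1,\beta_2,\beta_3};q\Bigr)=\sum_{k=0}^n\frac{(\alpha_1,\alpha_2,\alpha_3,q^{-n})_k}{(\beta_1,\beta_2,\beta_3,q)_k}\,q^k .$$ Standing assumption: parameters are such that no zero denominators occur. *)

theory Defs
  imports Complex_Main
begin

definition qpoch :: "complex \<Rightarrow> complex \<Rightarrow> nat \<Rightarrow> complex" where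
  "qpoch q x k = (\<Prod>j<k. 1 - x * q ^ j)"

definition qpochs :: "complex \<Rightarrow> complex list \<Rightarrow> nat \<Rightarrow> complex" where
  "qpochs q xs k = (\<Prod>x\<leftarrow>xs. qpoch q x k)"

text \<open>The terminating series with upper parameters \<open>\<alpha>1, \<alpha>2, \<alpha>3, q\<^sup>-\<^sup>n\<close>
  and lower parameters \<open>\<beta>1, \<beta>2, \<beta>3\<close>. The sum stops at the given \<open>n\<close>, so a lower
  parameter \<open>q\<^sup>-\<^sup>N\<close> with \<open>n \<le> N\<close> is harmless.\<close>

definition phi43 ::
  "complex \<Rightarrow> complex \<Rightarrow> complex \<Rightarrow> complex \<Rightarrow> nat \<Rightarrow> complex \<Rightarrow> complex \<Rightarrow> complex \<Rightarrow> complex" where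
  "phi43 q \<alpha>1 \<alpha>2 \<alpha>3 n \<beta>1 \<beta>2 \<beta>3 =
     (\<Sum>k\<le>n. qpochs q [\<alpha>1, \<alpha>2, \<alpha>3, q powi (- int n)] k / qpochs q [\<beta>1, \<beta>2, \<beta>3, q] k * q ^ k)"

definition phi43_defined ::
  "complex \<Rightarrow> nat \<Rightarrow> complex \<Rightarrow> complex \<Rightarrow> complex \<Rightarrow> bool" where
  "phi43_defined q n \<beta>1 \<beta>2 \<beta>3 \<longleftrightarrow> (\<forall>k\<le>n. qpochs q [\<beta>1, \<beta>2, \<beta>3, q] k \<noteq> 0)"

definition U_fun ::
  "complex \<Rightarrow> complex \<Rightarrow> complex \<Rightarrow> complex \<Rightarrow> complex \<Rightarrow> complex \<Rightarrow> nat \<Rightarrow> nat \<Rightarrow> complex \<Rightarrow> complex" where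
  "U_fun q a b d e \<mu> N n x =
     qpochs q [a * q, 2 * a * q * x / (b * d)] n / qpochs q [a * q / d, 2 * a * q * x / b] n *
     phi43 q (b\<^sup>2 * \<mu> * d * e / (a\<^sup>2 * q) * q powi (- int n)) d (b / (2 * x)) n
       (b\<^sup>2 * \<mu> * d * e / a * q powi (int N - int n))
       (q powi (- int N))
       (b * d / (2 * a * x) * q powi (- int n))"

definition V_fun ::
  "complex \<Rightarrow> complex \<Rightarrow> complex \<Rightarrow> complex \<Rightarrow> complex \<Rightarrow> complex \<Rightarrow> nat \<Rightarrow> nat \<Rightarrow> complex \<Rightarrow> complex" where
  "V_fun q a b d e \<mu> N m x =
     phi43 q (b / (2 * x)) (q powi (- int N + 1) / d)
       (a\<^sup>2 * q powi (1 - int N + int m) / (b\<^sup>2 * \<mu> * d * e)) m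
       (a * q powi (- int N + 2) / (2 * \<mu> * b * d * e * x))
       (a * q / d)
       (q powi (- int N))"

definition x_pt :: "complex \<Rightarrow> complex \<Rightarrow> nat \<Rightarrow> complex" where
  "x_pt q b k = 1 / 2 * b * q ^ k"

definition r_wt ::
  "complex \<Rightarrow> complex \<Rightarrow> complex \<Rightarrow> complex \<Rightarrow> complex \<Rightarrow> complex \<Rightarrow> nat \<Rightarrow> nat \<Rightarrow> complex" where
  "r_wt q a b d e \<mu> N k =
     qpochs q [a * q / d, q powi (- int N), \<mu> * b\<^sup>2 * d * e / (a * q) * q ^ N] k /
     qpochs q [a * q, \<mu> * b\<^sup>2 * e / a, q] k *
     q ^ k * (d / (a * q)) ^ N *
     (qpochs q [a * q, \<mu> * b\<^sup>2 * e / a] N /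
      qpochs q [d, \<mu> * b\<^sup>2 * d * e / (a\<^sup>2 * q)] N)"

definition C_norm ::
  "complex \<Rightarrow> complex \<Rightarrow> complex \<Rightarrow> complex \<Rightarrow> complex \<Rightarrow> complex \<Rightarrow> nat \<Rightarrow> nat \<Rightarrow> complex" where
  "C_norm q a b d e \<mu> N n =
     (q powi (- int N) / d) ^ n *
     (qpochs q [q, a * q powi (1 - int N) / (\<mu> * b\<^sup>2 * e), a\<^sup>2 * q\<^sup>2 / (\<mu> * b\<^sup>2 * d * e), a * q] n /
      qpochs q [q powi (- int N), a * q powi (1 - int N) / (\<mu> * b\<^sup>2 * d * e), a * q / d,
                a\<^sup>2 * q powi (2 - int N) / (\<mu> * b\<^sup>2 * d * e)] n) *
     ((1 - a\<^sup>2 * q powi (1 - int N + int n) / (\<mu> * b\<^sup>2 * d * e)) /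
      (1 - a\<^sup>2 * q powi (1 - int N + 2 * int n) / (\<mu> * b\<^sup>2 * d * e)))"

text \<open>All denominators of \<open>U\<^sub>n(x\<^sub>k)\<close>, \<open>V\<^sub>n(x\<^sub>k)\<close>, \<open>r\<^sub>k\<close> and \<open>C\<^sub>n\<close>
  (\<open>0 \<le> n, k \<le> N\<close>) that do not reduce to products of powers of \<open>2, q, a, b, d, e, \<mu>\<close>;
  those are nonzero as soon as these numbers are.\<close>

definition no_zero_denominators ::
  "complex \<Rightarrow> complex \<Rightarrow> complex \<Rightarrow> complex \<Rightarrow> complex \<Rightarrow> complex \<Rightarrow> nat \<Rightarrow> bool" where
  "no_zero_denominators q a b d e \<mu> N \<longleftrightarrow>
     (\<forall>n\<le>N. \<forall>k\<le>N.
        qpochs q [a * q / d, 2 * a * q * x_pt q b k / b] n \<noteq> 0 \<and>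
        phi43_defined q n
          (b\<^sup>2 * \<mu> * d * e / a * q powi (int N - int n))
          (q powi (- int N))
          (b * d / (2 * a * x_pt q b k) * q powi (- int n)) \<and>
        phi43_defined q n
          (a * q powi (- int N + 2) / (2 * \<mu> * b * d * e * x_pt q b k))
          (a * q / d)
          (q powi (- int N))) \<and>
     (\<forall>k\<le>N. qpochs q [a * q, \<mu> * b\<^sup>2 * e / a, q] k \<noteq> 0) \<and>
     qpochs q [d, \<mu> * b\<^sup>2 * d * e / (a\<^sup>2 * q)] N \<noteq> 0 \<and>
     (\<forall>n\<le>N.
        qpochs q [q powi (- int N), a * q powi (1 - int N) / (\<mu> * b\<^sup>2 * d * e), a * q / d,
                  a\<^sup>2 * q powi (2 - int N) / (\<mu> * b\<^sup>2 * d * e)] n \<noteq> 0 \<and>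
        1 - a\<^sup>2 * q powi (1 - int N + 2 * int n) / (\<mu> * b\<^sup>2 * d * e) \<noteq> 0)"

end

theory Submission
  imports Defs
begin

text \<open>Put \<open>p = \<mu>b\<^sup>2de q\<^sup>N / (aq)\<close> and \<open>c = a / p\<close>. Sears' transformation of the balanced
  \<open>\<^sub>4\<phi>\<^sub>3\<close> turns \<open>U\<^sub>n(x\<^sub>k)\<close> into a linear combination of
  \<open>\<psi>\<^sub>i(k) = (q\<^bsup>k-N\<^esup>)\<^sub>i / (aq\<^bsup>k+1\<^esup>)\<^sub>i\<close>, \<open>i \<le> n\<close>, while \<open>V\<^sub>m(x\<^sub>k)\<close> is by definition
  a combination of \<open>\<phi>\<^sub>j(k) = (q\<^bsup>-k\<^esup>)\<^sub>j / (q\<^bsup>1-k\<^esup> / p)\<^sub>j\<close>, \<open>j \<le> m\<close>. The sums of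
  \<open>r\<^sub>k \<phi>\<^sub>j(k) \<psi>\<^sub>i(k)\<close> over \<open>k\<close> are balanced \<open>\<^sub>3\<phi>\<^sub>2\<close> series; so are the ensuing sums over \<open>i\<close>, whose
  values vanish for \<open>j < n\<close>, and finally the sum over \<open>j\<close>, which vanishes for \<open>m > n\<close>. All of them,
  as well as Sears' transformation itself, are instances of the \<open>q\<close>-Saalschuetz formula.\<close>

section \<open>Elementary identities for q-shifted factorials\<close>

context
  fixes q :: complex
  assumes q_nonzero: "q \<noteq> 0"
    and q_not_root_of_unity: "\<And>n. 0 < n \<Longrightarrow> q ^ n \<noteq> 1"
begin

lemma qpoch_0 [simp]: "qpoch q x 0 = 1"
  by (simp add: qpoch_def)

lemma qpoch_Suc: "qpoch q x (Suc n) = qpoch q x n * (1 - x * q ^ n)"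
  by (simp add: qpoch_def)

lemma qpoch_add: "qpoch q x (m + n) = qpoch q x m * qpoch q (x * q ^ m) n"
  by (induction n) (simp_all add: qpoch_Suc power_add mult_ac)

lemma qpoch_Suc_left: "qpoch q x (Suc n) = (1 - x) * qpoch q (x * q) n"
  using qpoch_add[of x 1 n] by (simp add: qpoch_Suc)

lemma qpoch_split: "j \<le> n \<Longrightarrow> qpoch q x n = qpoch q x j * qpoch q (x * q ^ j) (n - j)"
  using qpoch_add[of x j "n - j"] by simp

lemma qpoch_nonzero_mono: "qpoch q x n \<noteq> 0 \<Longrightarrow> m \<le> n \<Longrightarrow> qpoch q x m \<noteq> 0"
  using qpoch_split[of m n x] by auto

lemma qpoch_q_nonzero: "qpoch q q n \<noteq> 0"
proof -
  have "1 - q * q ^ j \<noteq> 0" for j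
    using q_not_root_of_unity[of "Suc j"] by auto
  then show ?thesis
    by (simp add: qpoch_def)
qed

text \<open>The factors are read backwards: if \<open>x * y * q ^ (n - 1) = 1\<close>, then
  \<open>1 - x * q ^ j\<close> equals \<open>- x * q ^ j * (1 - y * q ^ (n - 1 - j))\<close>, and
  the exponents \<open>j\<close> add up to \<open>n choose 2\<close>. The hypothesis is this
  relation times \<open>q\<close>, which avoids division and subtraction; below, such
  \<open>x\<close> and \<open>y\<close> are called reflected in length \<open>n\<close>.\<close>

lemma qpoch_reverse:
  "x * y * q ^ n = q \<Longrightarrow> qpoch q x n = (- x) ^ n * q ^ (n choose 2) * qpoch q y n"
proof (induction n arbitrary: y)
  case (Suc n)
  have xy: "x * y * q ^ n = 1"
  proof -
    have "(x * y * q ^ n - 1) * q = 0"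
      using Suc.prems by (simp add: algebra_simps)
    then show ?thesis
      using q_nonzero by simp
  qed
  have IH: "qpoch q x n = (- x) ^ n * q ^ (n choose 2) * qpoch q (y * q) n"
    by (rule Suc.IH) (use Suc.prems in \<open>simp add: mult_ac\<close>)
  have "1 - x * q ^ n = (- x) * q ^ n * (1 - y)"
    using xy by (simp add: algebra_simps)
  moreover have "Suc n choose 2 = n + (n choose 2)"
    by (simp add: numeral_2_eq_2)
  ultimately show ?case
    unfolding qpoch_Suc[of x] qpoch_Suc_left[of y] IH by (simp add: power_add mult_ac)
qed (simp add: binomial_eq_0)

text \<open>Carries nonvanishing assumptions over to a reflected parameter, as from \<open>E\<close>
  to \<open>d / p\<close> or from \<open>q / (p * q ^ N)\<close> to \<open>p\<close>.\<close>

lemma qpoch_reverse_nonzero_iff: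
  assumes "x * y * q ^ n = q"
  shows "qpoch q x n \<noteq> 0 \<longleftrightarrow> qpoch q y n \<noteq> 0"
proof -
  have "x \<noteq> 0"
    using assms q_nonzero by auto
  then show ?thesis
    using qpoch_reverse[OF assms] q_nonzero by simp
qed

text \<open>Reversing \<open>(y)_j\<close> gives \<open>(x q^(k-j))_j\<close>, that is, the last
  \<open>j\<close> factors of \<open>(x)_k\<close>.\<close>

lemma qpoch_diff:
  assumes "x * y * q ^ k = q" and "j \<le> k"
  shows "qpoch q y j * qpoch q x (k - j) = (- y) ^ j * q ^ (j choose 2) * qpoch q x k"
proof -
  have "y * (x * q ^ (k - j)) * q ^ j = q"
    using assms by (simp add: mult_ac flip: power_add)
  from qpoch_reverse[OF this] show ?thesis
    using qpoch_split[of "k - j" k x] assms(2) by simp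
qed

lemma qpoch_neg_power:
  assumes "j \<le> k"
  shows "qpoch q (1 / q ^ k) j * qpoch q q (k - j) = (- 1 / q ^ k) ^ j * q ^ (j choose 2) * qpoch q q k"
  using qpoch_diff[of q "1 / q ^ k" k j] assms q_nonzero by simp

lemma qpoch_neg_power_eq_0: "k < j \<Longrightarrow> qpoch q (1 / q ^ k) j = 0"
  unfolding qpoch_def using q_nonzero by (intro prod_zero) auto

lemma qpoch_neg_power_nonzero: "j \<le> k \<Longrightarrow> qpoch q (1 / q ^ k) j \<noteq> 0"
  using qpoch_neg_power[of j k] qpoch_q_nonzero[of k] q_nonzero by auto

section \<open>The q-Saalschuetz sum and Sears' transformation\<close>

text \<open>The terms satisfy a Zeilberger-type recurrence whose inhomogeneous part telescopes;
  clearing all denominators makes the identity valid without any genericity assumption.\<close>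

lemma q_Saalschuetz_polynomial:
  "(\<Sum>j\<le>n. qpoch q q n / (qpoch q q j * qpoch q q (n - j)) * qpoch q A j * qpoch q B j *
      qpoch q (A * B * g * q ^ j) (n - j) * qpoch q g (n - j) * g ^ j) =
    qpoch q (A * g) n * qpoch q (B * g) n"
proof (induction n)
  case (Suc n)
  define T where "T n j = qpoch q q n / (qpoch q q j * qpoch q q (n - j)) * qpoch q A j * qpoch q B j *
      qpoch q (A * B * g * q ^ j) (n - j) * qpoch q g (n - j) * g ^ j" for n j
  \<comment> \<open>\<open>c\<close> is the quotient of the right-hand sides for
    \<open>Suc n\<close> and \<open>n\<close>, and \<open>h j * T n j\<close> is the certificate:
    \<open>T (Suc n) j = c * T n j + h j * T n j - h (j - 1) * T n (j - 1)\<close>. At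
    \<open>j = 0\<close> the last product is absent, at \<open>j = Suc n\<close> only that one
    survives.\<close>
  define c where "c = (1 - A * g * q ^ n) * (1 - B * g * q ^ n)"
  define h where "h j = - (q ^ (n - j)) * g * (1 - A * q ^ j) * (1 - B * q ^ j)" for j
  note nz = qpoch_q_nonzero
  have first: "T (Suc n) 0 = (c + h 0) * T n 0"
  proof -
    have "(1 - A * B * g * q ^ n) * (1 - g * q ^ n) = c + h 0"
      unfolding c_def h_def by (simp add: algebra_simps)
    moreover have "T (Suc n) 0 = T n 0 * ((1 - A * B * g * q ^ n) * (1 - g * q ^ n))"
      unfolding T_def diff_zero qpoch_Suc[of "A * B * g * q ^ 0"] qpoch_Suc[of g]
      using nz[of n] nz[of "Suc n"] by simp
    ultimately show ?thesis
      by simp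
  qed
  have last: "T (Suc n) (Suc n) = - h n * T n n"
    using nz[of n] nz[of "Suc n"] by (simp add: T_def h_def qpoch_Suc[of A] qpoch_Suc[of B])
  have middle: "T (Suc n) (Suc i) = (c + h (Suc i)) * T n (Suc i) - h i * T n i" if "i < n" for i
  proof -
    from that obtain r where n: "n = i + Suc r"
      using less_imp_Suc_add by auto
    define x y where "x = q ^ i" and "y = q ^ r"
    \<comment> \<open>Dividing by both \<open>(q)_(i+1)\<close> and \<open>(q)_(r+1)\<close> makes
      \<open>F\<close> a common factor of the three terms; the recurrence is then a polynomial
      identity in \<open>x\<close>, \<open>y\<close>, \<open>q\<close>, \<open>A\<close>,
      \<open>B\<close>, \<open>g\<close>.\<close>
    define K where "K = A * B * g * q ^ Suc i"
    define F where "F = qpoch q q n / (qpoch q q (Suc i) * qpoch q q (Suc r)) * qpoch q A i *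
      qpoch q B i * qpoch q K r * qpoch q g r * g ^ i"
    have qn: "q ^ n = x * y * q"
      by (simp add: n x_def y_def power_add)
    have nz': "1 - q * x \<noteq> 0" "1 - q * y \<noteq> 0"
      using nz[of "Suc i"] nz[of "Suc r"] by (auto simp: qpoch_Suc x_def y_def)
    have d: "Suc n - Suc i = Suc r" "n - Suc i = r" "n - i = Suc r"
      by (simp_all add: n)
    have K: "qpoch q K (Suc r) = qpoch q K r * (1 - A * B * g * x * q * y)"
      by (simp add: qpoch_Suc K_def x_def y_def mult_ac)
    have K': "qpoch q (A * B * g * q ^ i) (Suc r) = (1 - A * B * g * x) * qpoch q K r"
      by (simp add: qpoch_Suc_left K_def x_def mult_ac)
    have P: "qpoch q A (Suc i) = qpoch q A i * (1 - A * x)" "qpoch q B (Suc i) = qpoch q B i * (1 - B * x)"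
      "qpoch q g (Suc r) = qpoch q g r * (1 - g * y)" "qpoch q q (Suc n) = qpoch q q n * (1 - q * (x * y * q))"
      unfolding qpoch_Suc qn by (simp_all add: x_def y_def)
    have Q: "1 / qpoch q q r = (1 - q * y) / qpoch q q (Suc r)" "1 / qpoch q q i = (1 - q * x) / qpoch q q (Suc i)"
      unfolding qpoch_Suc[of q r] qpoch_Suc[of q i] using nz' by (simp_all add: x_def y_def)
    have e1: "T (Suc n) (Suc i) = F * ((1 - q * (x * y * q)) * (1 - A * x) * (1 - B * x) *
        (1 - A * B * g * x * q * y) * (1 - g * y) * g)"
      unfolding T_def F_def d K_def[symmetric] K P by (simp add: mult_ac)
    have "T n (Suc i) = qpoch q q n * (1 / qpoch q q r) / qpoch q q (Suc i) * qpoch q A (Suc i) *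
        qpoch q B (Suc i) * qpoch q K r * qpoch q g r * g ^ Suc i"
      unfolding T_def d K_def[symmetric] by simp
    then have e2: "T n (Suc i) = F * ((1 - q * y) * (1 - A * x) * (1 - B * x) * g)"
      unfolding F_def Q P by (simp add: mult_ac)
    have "T n i = qpoch q q n * (1 / qpoch q q i) / qpoch q q (Suc r) * qpoch q A i *
        qpoch q B i * qpoch q (A * B * g * q ^ i) (Suc r) * qpoch q g (Suc r) * g ^ i"
      unfolding T_def d by simp
    then have e3: "T n i = F * ((1 - q * x) * (1 - A * B * g * x) * (1 - g * y))"
      unfolding F_def Q P K' by (simp add: mult_ac)
    have h: "h (Suc i) = - y * g * (1 - A * (x * q)) * (1 - B * (x * q))"
            "h i = - (y * q) * g * (1 - A * x) * (1 - B * x)"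
      by (simp_all add: h_def d x_def y_def mult_ac)
    have "(1 - q * (x * y * q)) * (1 - A * x) * (1 - B * x) * (1 - A * B * g * x * q * y) * (1 - g * y) * g
      = (c + h (Suc i)) * ((1 - q * y) * (1 - A * x) * (1 - B * x) * g)
        - h i * ((1 - q * x) * (1 - A * B * g * x) * (1 - g * y))"
      unfolding c_def h qn by algebra
    then show ?thesis
      unfolding e1 e2 e3 by (simp only: right_diff_distrib mult.left_commute[of F])
  qed
  have sum_front: "(\<Sum>j\<le>n. f j) = f 0 + (\<Sum>i<n. f (Suc i))" for f :: "nat \<Rightarrow> complex"
    by (simp only: lessThan_Suc_atMost[symmetric] sum.lessThan_Suc_shift)
  have sum_back: "(\<Sum>j\<le>n. f j) = (\<Sum>i<n. f i) + f n" for f :: "nat \<Rightarrow> complex"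
    by (simp only: lessThan_Suc_atMost[symmetric] sum.lessThan_Suc)
  have "(\<Sum>j\<le>Suc n. T (Suc n) j) = T (Suc n) 0 + (\<Sum>i<n. T (Suc n) (Suc i)) + T (Suc n) (Suc n)"
    by (simp only: sum.atMost_Suc sum_front)
  also have "\<dots> = (c + h 0) * T n 0 + (\<Sum>i<n. (c + h (Suc i)) * T n (Suc i)) - ((\<Sum>i<n. h i * T n i) + h n * T n n)"
    by (simp add: first last middle sum_subtractf)
  also have "\<dots> = (\<Sum>j\<le>n. (c + h j) * T n j) - (\<Sum>j\<le>n. h j * T n j)"
    by (simp only: sum_front[of "\<lambda>j. (c + h j) * T n j"] sum_back[of "\<lambda>j. h j * T n j"])
  also have "\<dots> = c * (\<Sum>j\<le>n. T n j)"
    by (simp add: distrib_right sum.distrib sum_distrib_left)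
  also have "\<dots> = qpoch q (A * g) (Suc n) * qpoch q (B * g) (Suc n)"
    using Suc by (simp add: T_def c_def qpoch_Suc mult_ac)
  finally show ?case
    by (simp add: T_def)
qed simp

text \<open>The balancing condition says that \<open>g = C / (A * B)\<close> and \<open>D\<close>
  are reflected in length \<open>n\<close>, so dividing the polynomial form by \<open>(g)_n\<close>
  produces the series. Writing \<open>(C)_n / (C)_k\<close> as \<open>(C q^k)_(n-k)\<close> keeps
  the formula meaningful where \<open>(C)_n\<close> vanishes.\<close>

lemma q_Saalschuetz:
  assumes eq: "C * D * q ^ n = A * B * q" and nz: "A \<noteq> 0" "B \<noteq> 0" "C \<noteq> 0" "qpoch q D n \<noteq> 0"
  shows "(\<Sum>k\<le>n. qpoch q (1 / q ^ n) k * qpoch q A k * qpoch q B k * qpoch q (C * q ^ k) (n - k) /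
      (qpoch q q k * qpoch q D k) * q ^ k) =
    qpoch q (C / A) n * qpoch q (C / B) n / qpoch q (C / (A * B)) n"
proof -
  define g where "g = C / (A * B)"
  have gD: "g * D * q ^ n = q"
    using eq nz by (simp add: g_def field_simps)
  have gn: "qpoch q g n \<noteq> 0"
    using qpoch_reverse_nonzero_iff[OF gD] nz by simp
  have C: "A * B * g = C" "A * g = C / B" "B * g = C / A"
    using nz by (simp_all add: g_def)
  have summand: "qpoch q q n / (qpoch q q k * qpoch q q (n - k)) * qpoch q A k * qpoch q B k *
      qpoch q (C * q ^ k) (n - k) * qpoch q g (n - k) * g ^ k = qpoch q g n *
      (qpoch q (1 / q ^ n) k * qpoch q A k * qpoch q B k * qpoch q (C * q ^ k) (n - k) /
      (qpoch q q k * qpoch q D k) * q ^ k)" if "k \<le> n" for k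
  proof -
    have D: "qpoch q D k \<noteq> 0"
      using nz(4) that by (rule qpoch_nonzero_mono)
    have e1: "qpoch q g (n - k) = (- D) ^ k * q ^ (k choose 2) * qpoch q g n / qpoch q D k"
      using qpoch_diff[OF gD that] D by (simp add: field_simps)
    have e2: "qpoch q (1 / q ^ n) k = (- 1 / q ^ n) ^ k * q ^ (k choose 2) * qpoch q q n / qpoch q q (n - k)"
      using qpoch_neg_power[OF that] qpoch_q_nonzero[of "n - k"] by (simp add: field_simps)
    have e3: "(- D) ^ k * g ^ k = (- 1 / q ^ n) ^ k * q ^ k"
    proof -
      have "(- D) * g = (- 1 / q ^ n) * q"
        using gD q_nonzero by (simp add: field_simps)
      then show ?thesis
        by (metis power_mult_distrib)
    qed
    have "qpoch q q n / (qpoch q q k * qpoch q q (n - k)) * qpoch q A k * qpoch q B k *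
      qpoch q (C * q ^ k) (n - k) * qpoch q g (n - k) * g ^ k =
      qpoch q q n / (qpoch q q k * qpoch q q (n - k)) * qpoch q A k * qpoch q B k *
      qpoch q (C * q ^ k) (n - k) * (q ^ (k choose 2) * qpoch q g n / qpoch q D k) * ((- D) ^ k * g ^ k)"
      unfolding e1 by simp
    also have "\<dots> = qpoch q g n *
      (qpoch q (1 / q ^ n) k * qpoch q A k * qpoch q B k * qpoch q (C * q ^ k) (n - k) /
      (qpoch q q k * qpoch q D k) * q ^ k)"
      unfolding e2 e3 by (simp add: mult_ac)
    finally show ?thesis .
  qed
  have "qpoch q g n * (\<Sum>k\<le>n. qpoch q (1 / q ^ n) k * qpoch q A k * qpoch q B k *
      qpoch q (C * q ^ k) (n - k) / (qpoch q q k * qpoch q D k) * q ^ k) =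
      qpoch q (C / B) n * qpoch q (C / A) n"
    unfolding q_Saalschuetz_polynomial[of n A B g, unfolded C, symmetric] sum_distrib_left
    by (rule sum.cong) (simp_all only: summand atMost_iff)
  then show ?thesis
    using gn by (simp add: g_def[symmetric] field_simps)
qed

text \<open>Expand \<open>(B)_k (C)_k / (D)_k\<close> by the Saalschuetz sum, exchange the
  summations, and sum over \<open>l = k - j\<close> by Saalschuetz again. \<open>G\<close> and
  \<open>H\<close> are the lower parameters \<open>A q^(1-n) / F\<close> and
  \<open>A q^(1-n) / E\<close> of the transformed series; \<open>(G q^j)_(n-j)\<close> stands for
  \<open>(G)_n / (G)_j\<close>, and likewise for \<open>H\<close>.\<close>

lemma Sears_transformation:
  assumes eq: "A * B * C * q = D * E * F * q ^ n"
    and G: "G * F * q ^ n = A * q" and H: "H * E * q ^ n = A * q"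
    and nz: "A \<noteq> 0" "B \<noteq> 0" "C \<noteq> 0" "D \<noteq> 0" "E \<noteq> 0" "F \<noteq> 0"
    and nz': "qpoch q D n \<noteq> 0" "qpoch q E n \<noteq> 0" "qpoch q F n \<noteq> 0"
  shows "(\<Sum>k\<le>n. qpoch q A k * qpoch q B k * qpoch q C k * qpoch q (1 / q ^ n) k /
      (qpoch q D k * qpoch q E k * qpoch q F k * qpoch q q k) * q ^ k) =
    (B * C / D) ^ n / (qpoch q E n * qpoch q F n) *
    (\<Sum>j\<le>n. qpoch q (1 / q ^ n) j * qpoch q A j * qpoch q (D / B) j * qpoch q (D / C) j *
      qpoch q (G * q ^ j) (n - j) * qpoch q (H * q ^ j) (n - j) / (qpoch q q j * qpoch q D j) * q ^ j)"
proof -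
  define L where "L = B * C / D"
  \<comment> \<open>The term of the double sum at \<open>k = j + l\<close>. In
    \<open>q_Saalschuetz_polynomial\<close> the roles of \<open>A\<close>, \<open>B\<close>,
    \<open>g\<close> are taken by \<open>D / B\<close>, \<open>D / C\<close>, \<open>L\<close>, so
    that the value there is \<open>(C)_k (B)_k\<close>.\<close>
  define f where "f j l = qpoch q A (j + l) * qpoch q (1 / q ^ n) (j + l) * q ^ (j + l) /
      (qpoch q E (j + l) * qpoch q F (j + l)) *
      (qpoch q (D / B) j * qpoch q (D / C) j / (qpoch q q j * qpoch q D j) * L ^ j) *
      (qpoch q L l / qpoch q q l)" for j l
  have L0: "L \<noteq> 0"
    using nz by (simp add: L_def)
  have G0: "G \<noteq> 0"
    using G nz q_nonzero by auto
  have L: "A * L * q = E * F * q ^ n"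
    using eq nz by (simp add: L_def field_simps)
  have EG: "E = L * G"
  proof -
    have "(E - L * G) * (F * q ^ n) = E * F * q ^ n - L * (G * F * q ^ n)"
      by (simp add: algebra_simps)
    then have "(E - L * G) * (F * q ^ n) = 0"
      unfolding G L[symmetric] by simp
    then show ?thesis
      using nz q_nonzero by simp
  qed
  have outer: "qpoch q A k * qpoch q B k * qpoch q C k * qpoch q (1 / q ^ n) k /
      (qpoch q D k * qpoch q E k * qpoch q F k * qpoch q q k) * q ^ k = (\<Sum>j\<le>k. f j (k - j))"
    if "k \<le> n" for k
  proof -
    have Dk: "qpoch q D k \<noteq> 0"
      using nz'(1) that by (rule qpoch_nonzero_mono)
    have D: "D / B * (D / C) * L = D" "D / B * L = C" "D / C * L = B"
      using nz by (simp_all add: L_def)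
    have "(\<Sum>j\<le>k. f j (k - j)) = qpoch q A k * qpoch q (1 / q ^ n) k * q ^ k /
        (qpoch q D k * qpoch q E k * qpoch q F k * qpoch q q k) *
      (\<Sum>j\<le>k. qpoch q q k / (qpoch q q j * qpoch q q (k - j)) * qpoch q (D / B) j * qpoch q (D / C) j *
        qpoch q (D * q ^ j) (k - j) * qpoch q L (k - j) * L ^ j)"
      unfolding sum_distrib_left
    proof (rule sum.cong)
      fix j assume "j \<in> {..k}"
      then have j: "j \<le> k" by simp
      have Dj: "qpoch q D j \<noteq> 0"
        using Dk j by (rule qpoch_nonzero_mono)
      have "1 / qpoch q D j = qpoch q (D * q ^ j) (k - j) / qpoch q D k"
        using Dj Dk unfolding qpoch_split[OF j, of D] by simp
      moreover have "f j (k - j) = qpoch q A k * qpoch q (1 / q ^ n) k * q ^ k /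
        (qpoch q E k * qpoch q F k * qpoch q q k) * (1 / qpoch q D j) *
        (qpoch q q k / (qpoch q q j * qpoch q q (k - j)) * qpoch q (D / B) j * qpoch q (D / C) j *
          qpoch q L (k - j) * L ^ j)"
        using j qpoch_q_nonzero[of k] by (simp add: f_def mult_ac)
      ultimately show "f j (k - j) = qpoch q A k * qpoch q (1 / q ^ n) k * q ^ k /
        (qpoch q D k * qpoch q E k * qpoch q F k * qpoch q q k) *
        (qpoch q q k / (qpoch q q j * qpoch q q (k - j)) * qpoch q (D / B) j * qpoch q (D / C) j *
          qpoch q (D * q ^ j) (k - j) * qpoch q L (k - j) * L ^ j)"
        by (simp add: mult_ac)
    qed simp
    also have "\<dots> = qpoch q A k * qpoch q (1 / q ^ n) k * q ^ k /
        (qpoch q D k * qpoch q E k * qpoch q F k * qpoch q q k) * (qpoch q C k * qpoch q B k)"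
      unfolding q_Saalschuetz_polynomial[of k "D / B" "D / C" L, unfolded D] ..
    finally show ?thesis
      using Dk by (simp add: mult_ac)
  qed
  have inner: "(\<Sum>l\<le>n - j. f j l) = L ^ n / (qpoch q E n * qpoch q F n) *
      (qpoch q (1 / q ^ n) j * qpoch q A j * qpoch q (D / B) j * qpoch q (D / C) j *
      qpoch q (G * q ^ j) (n - j) * qpoch q (H * q ^ j) (n - j) / (qpoch q q j * qpoch q D j) * q ^ j)"
    if j: "j \<le> n" for j
  proof -
    define M where "M = n - j"
    have n: "n = j + M"
      using j by (simp add: M_def)
    define W where "W = qpoch q (1 / q ^ n) j * qpoch q A j * qpoch q (D / B) j * qpoch q (D / C) j /
      (qpoch q q j * qpoch q D j) * q ^ j"
    have FM: "qpoch q (F * q ^ j) M \<noteq> 0"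
      using nz'(3) unfolding n qpoch_add by simp
    have "(\<Sum>l\<le>M. f j l) = W * L ^ j / (qpoch q E n * qpoch q F j) *
      (\<Sum>l\<le>M. qpoch q (1 / q ^ M) l * qpoch q (A * q ^ j) l * qpoch q L l *
        qpoch q (E * q ^ j * q ^ l) (M - l) / (qpoch q q l * qpoch q (F * q ^ j) l) * q ^ l)"
      unfolding sum_distrib_left
    proof (rule sum.cong)
      fix l assume "l \<in> {..M}"
      then have l: "l \<le> M" by simp
      have "qpoch q (E * q ^ j) l \<noteq> 0"
        using nz'(2) qpoch_nonzero_mono[OF _ l] unfolding n qpoch_add by simp
      then have "1 / qpoch q E (j + l) = qpoch q (E * q ^ j * q ^ l) (M - l) / qpoch q E n"
        using nz'(2) unfolding n qpoch_add qpoch_split[OF l, of "E * q ^ j"] by simp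
      moreover have "1 / q ^ n * q ^ j = 1 / q ^ M"
        using q_nonzero by (simp add: n power_add)
      moreover have "f j l = qpoch q A j * qpoch q (A * q ^ j) l *
        (qpoch q (1 / q ^ n) j * qpoch q (1 / q ^ n * q ^ j) l) * q ^ j * q ^ l *
        (1 / qpoch q E (j + l)) / (qpoch q F j * qpoch q (F * q ^ j) l) *
        (qpoch q (D / B) j * qpoch q (D / C) j / (qpoch q q j * qpoch q D j) * L ^ j) *
        (qpoch q L l / qpoch q q l)"
        by (simp add: f_def power_add qpoch_add mult_ac)
      ultimately show "f j l = W * L ^ j / (qpoch q E n * qpoch q F j) *
        (qpoch q (1 / q ^ M) l * qpoch q (A * q ^ j) l * qpoch q L l *
        qpoch q (E * q ^ j * q ^ l) (M - l) / (qpoch q q l * qpoch q (F * q ^ j) l) * q ^ l)"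
        by (simp add: W_def mult_ac)
    qed simp
    also have "\<dots> = W * L ^ j / (qpoch q E n * qpoch q F j) *
      (qpoch q (E / A) M * qpoch q (G * q ^ j) M / qpoch q (G / A) M)"
    proof -
      have balance: "E * q ^ j * (F * q ^ j) * q ^ M = A * q ^ j * L * q"
        using L by (simp add: n power_add mult_ac)
      have ratios: "E * q ^ j / (A * q ^ j) = E / A" "E * q ^ j / L = G * q ^ j"
        "E * q ^ j / (A * q ^ j * L) = G / A"
        using q_nonzero L0 by (simp_all add: EG)
      have "A * q ^ j \<noteq> 0" "E * q ^ j \<noteq> 0"
        using nz q_nonzero by simp_all
      from q_Saalschuetz[OF balance this(1) L0 this(2) FM] show ?thesis
        by (simp only: ratios)
    qed
    \<comment> \<open>The parameters are reflected in length \<open>M\<close> to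
      \<open>H q^j\<close> and \<open>F q^j\<close>. As \<open>E = L * G\<close>, the powers cancel
      except for \<open>L ^ M\<close>, which joins \<open>L ^ j\<close> to give
      \<open>L ^ n\<close>.\<close>
    also have "qpoch q (E / A) M = (- (E / A)) ^ M * q ^ (M choose 2) * qpoch q (H * q ^ j) M"
      by (rule qpoch_reverse) (use H nz in \<open>simp add: n power_add field_simps\<close>)
    also have "qpoch q (G / A) M = (- (G / A)) ^ M * q ^ (M choose 2) * qpoch q (F * q ^ j) M"
      by (rule qpoch_reverse) (use G nz in \<open>simp add: n power_add field_simps\<close>)
    also have "(- (E / A)) ^ M = L ^ M * (- (G / A)) ^ M"
      by (simp add: EG flip: power_mult_distrib)
    also have "W * L ^ j / (qpoch q E n * qpoch q F j) * (L ^ M * (- (G / A)) ^ M * q ^ (M choose 2) *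
        qpoch q (H * q ^ j) M * qpoch q (G * q ^ j) M /
        ((- (G / A)) ^ M * q ^ (M choose 2) * qpoch q (F * q ^ j) M)) =
      L ^ n / (qpoch q E n * qpoch q F n) * (W * qpoch q (G * q ^ j) M * qpoch q (H * q ^ j) M)"
    proof -
      have "L ^ n = L ^ j * L ^ M" "qpoch q F n = qpoch q F j * qpoch q (F * q ^ j) M"
        by (simp_all add: n power_add qpoch_add)
      then show ?thesis
        using G0 nz q_nonzero by (simp add: mult_ac)
    qed
    finally show ?thesis
      by (simp add: W_def M_def mult_ac)
  qed
  have "(\<Sum>k\<le>n. qpoch q A k * qpoch q B k * qpoch q C k * qpoch q (1 / q ^ n) k /
      (qpoch q D k * qpoch q E k * qpoch q F k * qpoch q q k) * q ^ k) =
      (\<Sum>k\<le>n. \<Sum>j\<le>k. f j (k - j))"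
    by (rule sum.cong) (simp_all only: outer atMost_iff)
  also have "\<dots> = (\<Sum>(j, l)\<in>{(j, l). j + l \<le> n}. f j l)"
    by (rule sum.triangle_reindex_eq[symmetric])
  also have "{(j, l). j + l \<le> n} = Sigma {..n} (\<lambda>j. {..n - j})"
    by auto
  also have "(\<Sum>(j, l)\<in>\<dots>. f j l) = (\<Sum>j\<le>n. \<Sum>l\<le>n - j. f j l)"
    by (simp add: sum.Sigma)
  finally show ?thesis
    unfolding L_def[symmetric] sum_distrib_left
    by (rule trans) (rule sum.cong, simp_all only: inner atMost_iff)
qed

section \<open>Expansion of \<open>U_fun\<close> and moments of the two bases\<close>

lemma sum_window:
  fixes g :: "nat \<Rightarrow> complex"
  assumes "j + M \<le> N" and "\<And>k. k \<le> N \<Longrightarrow> k < j \<or> j + M < k \<Longrightarrow> g k = 0"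
  shows "(\<Sum>k\<le>N. g k) = (\<Sum>l\<le>M. g (j + l))"
proof -
  have "(\<Sum>k\<le>N. g k) = (\<Sum>k\<in>{j..j + M}. g k)"
    using assms by (intro sum.mono_neutral_right) (auto simp: not_le)
  also have "\<dots> = (\<Sum>l\<le>M. g (j + l))"
    by (simp add: sum.atLeastAtMost_shift_0 atLeast0AtMost)
  finally show ?thesis .
qed

text \<open>Lets \<open>(q ^ n) ^ n\<close> cancel against the two factors
  \<open>q ^ (n choose 2)\<close> that come from two reversals.\<close>

lemma square_eq_add_two_choose_two: "n * n = n + 2 * (n choose 2)"
  by (induction n) (simp_all add: numeral_2_eq_2)

text \<open>In Sears' transformation with \<open>C = 1 / q ^ k\<close>, the index \<open>k\<close>
  enters the new series only through \<open>D / C = q ^ k / q ^ N\<close> and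
  \<open>G = a * q * q ^ k\<close>. Every other coefficient is free of \<open>k\<close>, once the
  prefactor is simplified.\<close>

lemma biorthogonal_numerator_expansion:
  assumes a: "a = c * p" and nz: "c \<noteq> 0" "p \<noteq> 0" "d \<noteq> 0" and n: "n \<le> N"
    and nz': "qpoch q (p * q / q ^ n) n \<noteq> 0" "qpoch q (d / (a * q ^ k * q ^ n)) n \<noteq> 0"
      "qpoch q (a * q * q ^ k) n \<noteq> 0" "qpoch q (d / p) n \<noteq> 0"
  shows "qpoch q (a * q) n * qpoch q (a * q * q ^ k / d) n /
      (qpoch q (a * q / d) n * qpoch q (a * q * q ^ k) n) *
      (\<Sum>i\<le>n. qpoch q d i * qpoch q (1 / (c * q ^ N * q ^ n)) i * qpoch q (1 / q ^ k) i * qpoch q (1 / q ^ n) i /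
        (qpoch q (1 / q ^ N) i * qpoch q (p * q / q ^ n) i * qpoch q (d / (a * q ^ k * q ^ n)) i * qpoch q q i) * q ^ i) =
    qpoch q (a * q) n * qpoch q (d / p) n / (qpoch q (a * q / d) n * qpoch q (1 / p) n * d ^ n) *
      (\<Sum>i\<le>n. qpoch q (1 / q ^ n) i * qpoch q d i * qpoch q (c * q ^ n) i /
        (qpoch q q i * qpoch q (1 / q ^ N) i * qpoch q (d / p) i) * q ^ i *
        (qpoch q (q ^ k / q ^ N) i / qpoch q (a * q * q ^ k) i))"
proof -
  define B where "B = 1 / (c * q ^ N * q ^ n)"
  define C where "C = 1 / q ^ k"
  define D where "D = 1 / q ^ N"
  define E where "E = p * q / q ^ n"
  define F where "F = d / (a * q ^ k * q ^ n)"
  define G where "G = a * q * q ^ k"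
  define H where "H = d / p"
  define X where "X = a * q * q ^ k / d"
  have a0: "a \<noteq> 0"
    using a nz by simp
  note nonzero = nz a0 q_nonzero
  note defs = B_def C_def D_def E_def F_def G_def H_def X_def a
  have BCD: "B \<noteq> 0" "C \<noteq> 0" "D \<noteq> 0" "E \<noteq> 0" "F \<noteq> 0"
    using nonzero by (simp_all add: defs)
  have Dn: "qpoch q D n \<noteq> 0"
    unfolding D_def using n by (rule qpoch_neg_power_nonzero)
  have rel: "d * B * C * q = D * E * F * q ^ n" "G * F * q ^ n = d * q" "H * E * q ^ n = d * q"
    "E * (1 / p) * q ^ n = q" "F * X * q ^ n = q"
    using nonzero by (simp_all add: defs field_simps)
  have ratios: "D / B = c * q ^ n" "D / C = q ^ k / q ^ N"
    using nonzero by (simp_all add: defs)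
  have Sears: "(\<Sum>i\<le>n. qpoch q d i * qpoch q B i * qpoch q C i * qpoch q (1 / q ^ n) i /
      (qpoch q D i * qpoch q E i * qpoch q F i * qpoch q q i) * q ^ i) =
    (B * C / D) ^ n / (qpoch q E n * qpoch q F n) *
    (\<Sum>j\<le>n. qpoch q (1 / q ^ n) j * qpoch q d j * qpoch q (D / B) j * qpoch q (D / C) j *
      qpoch q (G * q ^ j) (n - j) * qpoch q (H * q ^ j) (n - j) / (qpoch q q j * qpoch q D j) * q ^ j)"
    by (rule Sears_transformation[OF rel(1-3) nz(3) BCD Dn nz'(1,2)[folded E_def F_def]])
  have summand: "qpoch q (1 / q ^ n) j * qpoch q d j * qpoch q (D / B) j * qpoch q (D / C) j *
      qpoch q (G * q ^ j) (n - j) * qpoch q (H * q ^ j) (n - j) / (qpoch q q j * qpoch q D j) * q ^ j =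
    qpoch q G n * qpoch q H n * (qpoch q (1 / q ^ n) j * qpoch q d j * qpoch q (c * q ^ n) j /
        (qpoch q q j * qpoch q D j * qpoch q H j) * q ^ j *
        (qpoch q (q ^ k / q ^ N) j / qpoch q G j))" if j: "j \<le> n" for j
  proof -
    have "qpoch q G j \<noteq> 0" "qpoch q H j \<noteq> 0"
      using nz' qpoch_nonzero_mono[OF _ j] by (auto simp: G_def H_def)
    then show ?thesis
      unfolding ratios qpoch_split[OF j, of G] qpoch_split[OF j, of H] by (simp add: mult_ac)
  qed
  have sum_eq: "(\<Sum>j\<le>n. qpoch q (1 / q ^ n) j * qpoch q d j * qpoch q (D / B) j * qpoch q (D / C) j *
      qpoch q (G * q ^ j) (n - j) * qpoch q (H * q ^ j) (n - j) / (qpoch q q j * qpoch q D j) * q ^ j) =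
    qpoch q G n * qpoch q H n * (\<Sum>j\<le>n. qpoch q (1 / q ^ n) j * qpoch q d j * qpoch q (c * q ^ n) j /
        (qpoch q q j * qpoch q D j * qpoch q H j) * q ^ j *
        (qpoch q (q ^ k / q ^ N) j / qpoch q G j))"
    unfolding sum_distrib_left by (rule sum.cong) (simp_all only: summand atMost_iff)
  \<comment> \<open>Here the prefactor loses its dependence on \<open>k\<close>:
    \<open>(F)_n\<close> reverses to \<open>(X)_n\<close>, which cancels, and \<open>(E)_n\<close>
    to \<open>(1/p)_n\<close>. By the balancing relation the remaining powers combine with
    \<open>(B * C / D) ^ n\<close> to \<open>1 / d ^ n\<close>.\<close>
  have prefactor: "(B * C / D) ^ n / (qpoch q E n * qpoch q F n) * qpoch q X n = 1 / (qpoch q (1 / p) n * d ^ n)"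
  proof -
    have rev: "qpoch q E n = (- E) ^ n * q ^ (n choose 2) * qpoch q (1 / p) n"
      "qpoch q F n = (- F) ^ n * q ^ (n choose 2) * qpoch q X n"
      using rel by (auto intro: qpoch_reverse)
    have X: "qpoch q X n \<noteq> 0"
      using nz' rev by (auto simp: F_def)
    have "(q ^ n) ^ n = q ^ n * (q ^ (n choose 2))\<^sup>2"
      by (simp add: square_eq_add_two_choose_two flip: power_mult power_add) (simp add: mult.commute)
    moreover have "B * C / D * d * q = (- E) * (- F) * q ^ n"
      using nonzero by (simp add: defs field_simps)
    then have "(B * C / D) ^ n * d ^ n * q ^ n = (- E) ^ n * (- F) ^ n * (q ^ n) ^ n"
      by (metis power_mult_distrib)
    ultimately have "(B * C / D) ^ n * d ^ n * q ^ n = (- E) ^ n * (- F) ^ n * (q ^ n * (q ^ (n choose 2))\<^sup>2)"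
      by simp
    then have "(B * C / D) ^ n * d ^ n = (- E) ^ n * (- F) ^ n * (q ^ (n choose 2))\<^sup>2"
      using q_nonzero by simp
    then have "(B * C / D) ^ n = (- E) ^ n * (- F) ^ n * (q ^ (n choose 2))\<^sup>2 / d ^ n"
      using nz by (simp add: field_simps)
    then show ?thesis
      unfolding rev using X BCD q_nonzero by (simp add: power2_eq_square)
  qed
  have "qpoch q (a * q) n * qpoch q X n / (qpoch q (a * q / d) n * qpoch q G n) *
      (\<Sum>i\<le>n. qpoch q d i * qpoch q B i * qpoch q C i * qpoch q (1 / q ^ n) i /
        (qpoch q D i * qpoch q E i * qpoch q F i * qpoch q q i) * q ^ i) =
    qpoch q (a * q) n / (qpoch q (a * q / d) n * qpoch q G n) *
      ((B * C / D) ^ n / (qpoch q E n * qpoch q F n) * qpoch q X n) * (qpoch q G n * qpoch q H n) *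
      (\<Sum>j\<le>n. qpoch q (1 / q ^ n) j * qpoch q d j * qpoch q (c * q ^ n) j /
        (qpoch q q j * qpoch q D j * qpoch q H j) * q ^ j *
        (qpoch q (q ^ k / q ^ N) j / qpoch q G j))"
    unfolding Sears sum_eq by (simp only: times_divide_eq_left times_divide_eq_right divide_divide_eq_left mult_ac)
  also have "\<dots> = qpoch q (a * q) n * qpoch q H n / (qpoch q (a * q / d) n * qpoch q (1 / p) n * d ^ n) *
      (\<Sum>j\<le>n. qpoch q (1 / q ^ n) j * qpoch q d j * qpoch q (c * q ^ n) j /
        (qpoch q q j * qpoch q D j * qpoch q H j) * q ^ j *
        (qpoch q (q ^ k / q ^ N) j / qpoch q G j))"
    unfolding prefactor using nz'(3) by (simp add: G_def)
  finally show ?thesis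
    by (simp only: B_def C_def D_def E_def F_def G_def H_def X_def)
qed

text \<open>The factor of index \<open>j\<close> cuts the sum off below and that of index
  \<open>i\<close> above, leaving \<open>j \<le> k \<le> N - i\<close>. After the shift
  \<open>k = j + l\<close> a balanced series terminating at \<open>N - j - i\<close> remains, which
  \<open>q_Saalschuetz\<close> sums.\<close>

lemma basis_moment:
  assumes nz: "a \<noteq> 0" "d \<noteq> 0" "p \<noteq> 0" and E: "E * d * q ^ N = p * q"
    and nz': "qpoch q (a * q) N \<noteq> 0" "qpoch q E N \<noteq> 0" "qpoch q p N \<noteq> 0"
    and ij: "i \<le> N" "j \<le> N"
  shows "(\<Sum>k\<le>N. qpoch q (a * q / d) k * qpoch q (1 / q ^ N) k * qpoch q p k /
        (qpoch q (a * q) k * qpoch q E k * qpoch q q k) * q ^ k *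
        (qpoch q (1 / q ^ k) j / qpoch q (q / (p * q ^ k)) j) *
        (qpoch q (q ^ k / q ^ N) i / qpoch q (a * q * q ^ k) i)) =
    (if i + j \<le> N then p ^ j * qpoch q (a * q / d) j * qpoch q (1 / q ^ N) (i + j) *
        qpoch q (d * q ^ i) (N - j - i) * qpoch q (a / p * q ^ (1 + j) * q ^ i) (N - j - i) /
        (qpoch q E j * qpoch q (a * q) N * qpoch q (d / p * q ^ i) (N - j - i)) else 0)"
    (is "(\<Sum>k\<le>N. ?g k) = _")
proof -
  have low: "?g k = 0" if "k < j" for k
    using that by (simp add: qpoch_neg_power_eq_0)
  \<comment> \<open>A factor of the weight and the numerator of index \<open>i\<close> glue to one
    factorial, which contains a zero as soon as \<open>k + i > N\<close>.\<close>
  have psi: "qpoch q (1 / q ^ N) k * qpoch q (q ^ k / q ^ N) i = qpoch q (1 / q ^ N) (k + i)" for k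
    by (simp add: qpoch_add)
  have high: "?g k = 0" if "N < k + i" for k
    using psi[of k] that by (auto simp: qpoch_neg_power_eq_0)
  show ?thesis
  proof (cases "i + j \<le> N")
    case False
    have "(\<Sum>k\<le>N. ?g k) = 0"
    proof (rule sum.neutral, rule ballI)
      show "?g k = 0" for k
        using low[of k] high[of k] False by linarith
    qed
    then show ?thesis
      using False by (simp only: if_False)
  next
    case True
    define M where "M = N - j - i"
    have N: "N = j + M + i"
      using True by (simp add: M_def)
    have D: "qpoch q (E * q ^ j) M \<noteq> 0"
      using nz'(2) unfolding N qpoch_add[of E "j + M"] qpoch_add[of E j] by simp
    define W where "W = p ^ j * qpoch q (a * q / d) j * qpoch q (1 / q ^ N) (i + j) /
      (qpoch q E j * qpoch q (a * q) N)"
    define C where "C = a * q * q ^ (i + j)"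
    have "(\<Sum>k\<le>N. ?g k) = (\<Sum>l\<le>M. ?g (j + l))"
      by (rule sum_window) (use low high in \<open>auto simp: N\<close>)
    also have "\<dots> = W * (\<Sum>l\<le>M. qpoch q (1 / q ^ M) l * qpoch q (a * q / d * q ^ j) l * qpoch q p l *
      qpoch q (C * q ^ l) (M - l) / (qpoch q q l * qpoch q (E * q ^ j) l) * q ^ l)"
      unfolding sum_distrib_left
    proof (rule sum.cong)
      fix l assume "l \<in> {..M}"
      then have l: "l \<le> M" by simp
      define k where "k = j + l"
      have k: "j \<le> k" "k - j = l" "k \<le> N"
        using l by (simp_all add: k_def N)
      have pk: "qpoch q p k \<noteq> 0"
        using nz'(3) k(3) by (rule qpoch_nonzero_mono)
      have "p * (q / (p * q ^ k)) * q ^ k = q"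
        using nz q_nonzero by simp
      from qpoch_diff[OF this k(1)]
      have den: "qpoch q (q / (p * q ^ k)) j * qpoch q p l =
          (- (q / (p * q ^ k))) ^ j * q ^ (j choose 2) * qpoch q p k"
        by (simp add: k)
      have num: "qpoch q (1 / q ^ k) j * qpoch q q l = (- 1 / q ^ k) ^ j * q ^ (j choose 2) * qpoch q q k"
        using qpoch_neg_power[OF k(1)] by (simp add: k)
      have den0: "qpoch q (q / (p * q ^ k)) j \<noteq> 0"
        using den pk nz q_nonzero by auto
      have pw: "p ^ j * (- (q / (p * q ^ k))) ^ j = (- 1 / q ^ k) ^ j * q ^ j"
        using nz by (simp flip: power_mult_distrib)
      \<comment> \<open>The quotient of index \<open>j\<close> lowers the \<open>p\<close> and
        \<open>q\<close> factorials of the weight from index \<open>k\<close> to \<open>l\<close>,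
        at the cost of \<open>p ^ j\<close>; the \<open>q ^ j\<close> is split off from
        \<open>q ^ k\<close>.\<close>
      have phi: "qpoch q p k / qpoch q q k * q ^ j * (qpoch q (1 / q ^ k) j / qpoch q (q / (p * q ^ k)) j) =
          p ^ j * qpoch q p l / qpoch q q l"
      proof -
        have "qpoch q p k * q ^ j * qpoch q (1 / q ^ k) j * qpoch q q l * q ^ (j choose 2) =
            p ^ j * qpoch q p l * qpoch q q k * qpoch q (q / (p * q ^ k)) j * q ^ (j choose 2)"
        proof -
          have "qpoch q p k * q ^ j * qpoch q (1 / q ^ k) j * qpoch q q l * q ^ (j choose 2) =
            qpoch q p k * q ^ j * q ^ (j choose 2) * (qpoch q (1 / q ^ k) j * qpoch q q l)"
            by simp
          also have "\<dots> = qpoch q p k * q ^ (j choose 2) * q ^ (j choose 2) * qpoch q q k * ((- 1 / q ^ k) ^ j * q ^ j)"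
            unfolding num by simp
          also have "\<dots> = p ^ j * q ^ (j choose 2) * qpoch q q k *
              ((- (q / (p * q ^ k))) ^ j * q ^ (j choose 2) * qpoch q p k)"
            unfolding pw[symmetric] by simp
          also have "\<dots> = p ^ j * qpoch q p l * qpoch q q k * qpoch q (q / (p * q ^ k)) j * q ^ (j choose 2)"
            unfolding den[symmetric] by simp
          finally show ?thesis .
        qed
        then have "qpoch q p k * q ^ j * qpoch q (1 / q ^ k) j * qpoch q q l =
            p ^ j * qpoch q p l * qpoch q q k * qpoch q (q / (p * q ^ k)) j"
          using q_nonzero by simp
        then show ?thesis
          using den0 qpoch_q_nonzero[of k] qpoch_q_nonzero[of l] by (simp add: field_simps)
      qed
      have S: "N = i + j + l + (M - l)"
        using l by (simp add: N)
      \<comment> \<open>The denominators glue to \<open>(aq)_(k+i)\<close>. Expressing it as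
        \<open>(aq)_N\<close> over the remaining factors creates the numerator
        \<open>(C q^l)_(M-l)\<close> of \<open>q_Saalschuetz\<close>.\<close>
      have aq: "1 / (qpoch q (a * q) k * qpoch q (a * q * q ^ k) i) = qpoch q (C * q ^ l) (M - l) / qpoch q (a * q) N"
      proof -
        have "qpoch q (a * q) N = qpoch q (a * q) (i + j + l) * qpoch q (C * q ^ l) (M - l)"
          using qpoch_add[of "a * q" "i + j + l" "M - l"] S by (simp add: C_def power_add mult_ac)
        moreover have "qpoch q (a * q) k * qpoch q (a * q * q ^ k) i = qpoch q (a * q) (i + j + l)"
          by (simp add: k_def add_ac flip: qpoch_add)
        ultimately show ?thesis
          using nz'(1) by auto
      qed
      have neg: "qpoch q (1 / q ^ N) k * qpoch q (q ^ k / q ^ N) i = qpoch q (1 / q ^ N) (i + j) * qpoch q (1 / q ^ M) l"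
      proof -
        have "1 / q ^ N * q ^ (i + j) = 1 / q ^ M"
          using q_nonzero by (simp add: N power_add)
        then show ?thesis
          unfolding psi using qpoch_add[of "1 / q ^ N" "i + j" l] by (simp add: k_def add_ac)
      qed
      have "?g k = qpoch q (a * q / d) k / qpoch q E k * q ^ l *
          (qpoch q (1 / q ^ N) k * qpoch q (q ^ k / q ^ N) i) *
          (1 / (qpoch q (a * q) k * qpoch q (a * q * q ^ k) i)) *
          (qpoch q p k / qpoch q q k * q ^ j * (qpoch q (1 / q ^ k) j / qpoch q (q / (p * q ^ k)) j))"
        by (simp add: k_def power_add mult_ac)
      also have "\<dots> = W * (qpoch q (1 / q ^ M) l * qpoch q (a * q / d * q ^ j) l * qpoch q p l *
          qpoch q (C * q ^ l) (M - l) / (qpoch q q l * qpoch q (E * q ^ j) l) * q ^ l)"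
        unfolding phi neg aq by (simp add: W_def k_def qpoch_add mult_ac)
      finally show "?g (j + l) = W * (qpoch q (1 / q ^ M) l * qpoch q (a * q / d * q ^ j) l * qpoch q p l *
          qpoch q (C * q ^ l) (M - l) / (qpoch q q l * qpoch q (E * q ^ j) l) * q ^ l)"
        by (simp only: k_def)
    qed simp
    also have "\<dots> = W * (qpoch q (d * q ^ i) M * qpoch q (a / p * q ^ (1 + j) * q ^ i) M / qpoch q (d / p * q ^ i) M)"
    proof -
      have balance: "C * (E * q ^ j) * q ^ M = a * q / d * q ^ j * p * q"
      proof -
        have "C * (E * q ^ j) * q ^ M * d = a * q * q ^ j * (E * d * q ^ N)"
          by (simp add: C_def N power_add mult_ac)
        then show ?thesis
          unfolding E using nz by (simp add: field_simps)
      qed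
      have ratios: "C / (a * q / d * q ^ j) = d * q ^ i" "C / p = a / p * q ^ (1 + j) * q ^ i"
        "C / (a * q / d * q ^ j * p) = d / p * q ^ i"
        using nz q_nonzero by (simp_all add: C_def power_add)
      have "a * q / d * q ^ j \<noteq> 0" "C \<noteq> 0"
        using nz q_nonzero by (simp_all add: C_def)
      from q_Saalschuetz[OF balance this(1) nz(3) this(2) D] show ?thesis
        by (simp only: ratios)
    qed
    finally show ?thesis
      using True by (simp add: W_def M_def)
  qed
qed

text \<open>This quotient occurs in the Saalschuetz value behind \<open>numerator_moment\<close>.
  For \<open>j < n\<close> the exponents \<open>1+j-n, ..., N-n\<close> of its numerator include 0;
  that zero is responsible for biorthogonality when \<open>m < n\<close>.\<close>

lemma qpoch_ratio_shift:
  assumes "j \<le> N" "n \<le> N"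
  shows "qpoch q (q ^ (1 + j) / q ^ n) (N - j) / qpoch q (q ^ (1 + j)) (N - j) =
    (if j < n then 0 else qpoch q q (N - n) * qpoch q q j / (qpoch q q (j - n) * qpoch q q N))"
proof (cases "j < n")
  case True
  define r where "r = n - 1 - j"
  have "n = r + (1 + j)"
    using True by (simp add: r_def)
  then have "q ^ (1 + j) / q ^ n = 1 / q ^ r"
    using q_nonzero by (simp add: power_add)
  moreover have "r < N - j"
    using True assms by (simp add: r_def)
  ultimately show ?thesis
    using True by (simp add: qpoch_neg_power_eq_0)
next
  case False
  have "q ^ (1 + j) / q ^ n = q * q ^ (j - n)"
    using False q_nonzero by (simp add: power_diff)
  moreover have "qpoch q q (N - n) = qpoch q q (j - n) * qpoch q (q * q ^ (j - n)) (N - j)"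
    using qpoch_add[of q "j - n" "N - j"] False assms by simp
  moreover have "qpoch q q N = qpoch q q j * qpoch q (q * q ^ j) (N - j)"
    using assms(1) by (rule qpoch_split)
  ultimately show ?thesis
    using False qpoch_q_nonzero[of j] qpoch_q_nonzero[of "j - n"] by simp
qed

text \<open>Under the sum over \<open>i\<close>, \<open>(d)_i\<close> and
  \<open>(d q^i)_(N-j-i)\<close> glue to the constant \<open>(d)_(N-j)\<close>, and similarly for
  \<open>d / p\<close>. What is left is a balanced series with termination index
  \<open>N - j\<close>.\<close>

lemma numerator_moment:
  assumes a: "a = c * p" and nz: "c \<noteq> 0" "p \<noteq> 0"
    and nz': "qpoch q (d / p) N \<noteq> 0" and nj: "n \<le> N" "j \<le> N"
  shows "(\<Sum>i\<le>n. qpoch q (1 / q ^ n) i * qpoch q d i * qpoch q (c * q ^ n) i /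
        (qpoch q q i * qpoch q (1 / q ^ N) i * qpoch q (d / p) i) * q ^ i *
      (if i + j \<le> N then p ^ j * qpoch q (a * q / d) j * qpoch q (1 / q ^ N) (i + j) *
        qpoch q (d * q ^ i) (N - j - i) * qpoch q (a / p * q ^ (1 + j) * q ^ i) (N - j - i) /
        (qpoch q E j * qpoch q (a * q) N * qpoch q (d / p * q ^ i) (N - j - i)) else 0)) =
    p ^ j * qpoch q (a * q / d) j * qpoch q d (N - j) * qpoch q (1 / q ^ N) j /
      (qpoch q E j * qpoch q (a * q) N * qpoch q (d / p) (N - j)) *
    (if j < n then 0 else qpoch q (c * q ^ (1 + j) * q ^ n) (N - j) *
      (qpoch q q (N - n) * qpoch q q j / (qpoch q q (j - n) * qpoch q q N)))"
    (is "(\<Sum>i\<le>n. ?g i) = ?W * _")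
proof -
  define C where "C = c * q ^ (1 + j)"
  have C: "a / p * q ^ (1 + j) = C"
    using nz by (simp add: a C_def)
  have "(\<Sum>i\<le>n. ?g i) = (\<Sum>i\<le>N - j. ?W * (qpoch q (1 / q ^ (N - j)) i * qpoch q (1 / q ^ n) i * qpoch q (c * q ^ n) i *
      qpoch q (C * q ^ i) (N - j - i) / (qpoch q q i * qpoch q (1 / q ^ N) i) * q ^ i))"
  \<comment> \<open>The surplus terms of either range vanish: for \<open>i > N - j\<close> by the
    case distinction, for \<open>i > n\<close> by the factor \<open>(q^-n)_i\<close>.\<close>
  proof (rule sum.mono_neutral_cong)
    fix i assume "i \<in> {..n} \<inter> {..N - j}"
    then have i: "i \<le> N - j" by simp
    then have "i + j \<le> N"
      using nj by linarith
    have "qpoch q (d / p) i \<noteq> 0"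
      by (rule qpoch_nonzero_mono[OF nz']) (use i in simp)
    moreover have "1 / q ^ N * q ^ j = 1 / q ^ (N - j)"
      using q_nonzero nj by (simp add: power_diff)
    then have "qpoch q (1 / q ^ N) (i + j) = qpoch q (1 / q ^ N) j * qpoch q (1 / q ^ (N - j)) i"
      using qpoch_add[of "1 / q ^ N" j i] by (simp add: add_ac)
    ultimately show "?g i = ?W * (qpoch q (1 / q ^ (N - j)) i * qpoch q (1 / q ^ n) i * qpoch q (c * q ^ n) i *
      qpoch q (C * q ^ i) (N - j - i) / (qpoch q q i * qpoch q (1 / q ^ N) i) * q ^ i)"
      unfolding C qpoch_split[OF i, of d] qpoch_split[OF i, of "d / p"] using \<open>i + j \<le> N\<close> by (simp add: mult_ac)
  qed (use nj in \<open>auto simp: qpoch_neg_power_eq_0\<close>)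
  also have "\<dots> = ?W * (qpoch q (c * q ^ (1 + j) * q ^ n) (N - j) *
      (qpoch q (q ^ (1 + j) / q ^ n) (N - j) / qpoch q (q ^ (1 + j)) (N - j)))"
  proof -
    have balance: "C * (1 / q ^ N) * q ^ (N - j) = 1 / q ^ n * (c * q ^ n) * q"
      using q_nonzero nj by (simp add: C_def power_diff)
    have ratios: "C / (1 / q ^ n) = c * q ^ (1 + j) * q ^ n" "C / (c * q ^ n) = q ^ (1 + j) / q ^ n"
      "C / (1 / q ^ n * (c * q ^ n)) = q ^ (1 + j)"
      using nz q_nonzero by (simp_all add: C_def)
    have "1 / q ^ n \<noteq> 0" "c * q ^ n \<noteq> 0" "C \<noteq> 0"
      using nz q_nonzero by (simp_all add: C_def)
    from q_Saalschuetz[OF balance this qpoch_neg_power_nonzero] show ?thesis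
      unfolding sum_distrib_left[symmetric] ratios by simp
  qed
  finally show ?thesis
    unfolding qpoch_ratio_shift[OF nj(2) nj(1)] by (simp only: if_distrib mult_zero_right)
qed

section \<open>Biorthogonality in the reduced parameters\<close>

text \<open>For \<open>m > n\<close> this is a \<open>q\<close>-Vandermonde sum, obtained from the Saalschuetz sum
  by the choice \<open>B = D = q\<close>.\<close>

lemma biorthogonality_sum:
  assumes "c \<noteq> 0" and nm: "n \<le> N" "m \<le> N"
  shows "(\<Sum>j\<le>m. qpoch q (c * q ^ m) j * qpoch q (1 / q ^ m) j * q ^ j *
      (if j < n then 0 else qpoch q (c * q ^ (1 + j) * q ^ n) (N - j) / qpoch q q (j - n))) =
    (if n = m then qpoch q (c * q ^ n) n * qpoch q (1 / q ^ n) n * q ^ n *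
       qpoch q (c * q ^ (1 + 2 * n)) (N - n) else 0)"
    (is "(\<Sum>j\<le>m. ?g j) = _")
proof (cases "n \<le> m")
  case False
  then have "(\<Sum>j\<le>m. ?g j) = 0"
    by (intro sum.neutral) auto
  then show ?thesis
    using False by auto
next
  case True
  define M where "M = m - n"
  define C where "C = c * q ^ (1 + 2 * n)"
  have m: "m = n + M"
    using True by (simp add: M_def)
  \<comment> \<open>The tail \<open>(C q^M)_(N-n-M)\<close> is common to all terms; splitting it off
    leaves the length \<open>M - l\<close> that \<open>q_Saalschuetz\<close> requires.\<close>
  define W where "W = qpoch q (c * q ^ m) n * qpoch q (1 / q ^ m) n * q ^ n * qpoch q (C * q ^ M) (N - n - M)"
  have "(\<Sum>j\<le>m. ?g j) = (\<Sum>l\<le>M. ?g (n + l))"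
    by (rule sum_window) (auto simp: m)
  also have "\<dots> = W * (\<Sum>l\<le>M. qpoch q (1 / q ^ M) l * qpoch q (c * q ^ m * q ^ n) l * qpoch q q l *
      qpoch q (C * q ^ l) (M - l) / (qpoch q q l * qpoch q q l) * q ^ l)"
    unfolding sum_distrib_left
  proof (rule sum.cong)
    fix l assume "l \<in> {..M}"
    then have l: "l \<le> M" by simp
    have "N - (n + l) = (M - l) + (N - n - M)" "q ^ l * q ^ (M - l) = q ^ M"
      using l nm by (simp_all add: m flip: power_add)
    moreover from this have "qpoch q (C * q ^ l) (N - (n + l)) = qpoch q (C * q ^ l) (M - l) * qpoch q (C * q ^ M) (N - n - M)"
      using qpoch_add[of "C * q ^ l" "M - l" "N - n - M"] by (simp add: mult_ac)
    moreover have "c * q ^ (1 + (n + l)) * q ^ n = C * q ^ l"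
      by (simp add: C_def power_add mult_2)
    moreover have "1 / q ^ m * q ^ n = 1 / q ^ M"
      using q_nonzero by (simp add: m power_add)
    moreover have "?g (n + l) = qpoch q (c * q ^ m) n * qpoch q (c * q ^ m * q ^ n) l *
        (qpoch q (1 / q ^ m) n * qpoch q (1 / q ^ m * q ^ n) l) * (q ^ n * q ^ l) *
        (qpoch q (c * q ^ (1 + (n + l)) * q ^ n) (N - (n + l)) / qpoch q q l)"
      by (simp add: qpoch_add power_add)
    ultimately show "?g (n + l) = W * (qpoch q (1 / q ^ M) l * qpoch q (c * q ^ m * q ^ n) l * qpoch q q l *
      qpoch q (C * q ^ l) (M - l) / (qpoch q q l * qpoch q q l) * q ^ l)"
      using qpoch_q_nonzero[of l] by (simp only:) (simp add: W_def)
  qed simp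
  also have "\<dots> = (if n = m then W else 0)"
  proof (cases "n = m")
    case True
    then show ?thesis by (simp add: M_def)
  next
    case False
    then obtain r where r: "M = Suc r"
      using m by (cases M) auto
    have balance: "C * q * q ^ M = c * q ^ m * q ^ n * q * q"
      by (simp add: C_def m power_add mult_2)
    \<comment> \<open>The quotient is \<open>q^(1-M)\<close>, so its factorial of length
      \<open>M > 0\<close> has a zero factor: this is the vanishing for
      \<open>m > n\<close>.\<close>
    have "C / (c * q ^ m * q ^ n) = 1 / q ^ r"
      using assms(1) q_nonzero by (simp add: C_def m r power_add mult_2)
    then have "qpoch q (C / (c * q ^ m * q ^ n)) M = 0"
      by (simp add: qpoch_neg_power_eq_0 r)
    moreover have "c * q ^ m * q ^ n \<noteq> 0" "C \<noteq> 0"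
      using assms q_nonzero by (simp_all add: C_def)
    note q_Saalschuetz[OF balance this(1) q_nonzero this(2) qpoch_q_nonzero]
    ultimately show ?thesis
      using False by simp
  qed
  finally show ?thesis
    by (simp add: W_def C_def M_def)
qed

text \<open>The identity is a product of two: one free of \<open>c\<close>, settled by reversing
  \<open>(q^-n)_n\<close> and the last \<open>n\<close> factors of \<open>(q)_N\<close>, and one
  carrying \<open>c\<close>, settled by regluing factorials.\<close>

lemma biorthogonality_constant:
  assumes nN: "n \<le> N" and nz: "qpoch q (c * q) N \<noteq> 0" "1 - c * q ^ (2 * n) \<noteq> 0"
  shows "qpoch q q (N - n) / (qpoch q (c * q) N * qpoch q q N) *
      (qpoch q (c * q ^ n) n * qpoch q (1 / q ^ n) n * q ^ n * qpoch q (c * q ^ (1 + 2 * n)) (N - n)) =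
    (1 / q ^ N) ^ n * (qpoch q q n * qpoch q (c * q ^ (N + 1)) n / (qpoch q (1 / q ^ N) n * qpoch q (c * q) n)) *
      ((1 - c * q ^ n) / (1 - c * q ^ (2 * n)))"
proof -
  have "qpoch q q (N - n) / qpoch q q N * (qpoch q (1 / q ^ n) n * q ^ n) =
      (1 / q ^ N) ^ n * (qpoch q q n / qpoch q (1 / q ^ N) n)"
  proof -
    have top: "qpoch q (1 / q ^ n) n = (- 1 / q ^ n) ^ n * q ^ (n choose 2) * qpoch q q n"
      using qpoch_neg_power[of n n] by simp
    have "(q ^ n) ^ n = q ^ n * (q ^ (n choose 2) * q ^ (n choose 2))"
      by (simp add: square_eq_add_two_choose_two flip: power_mult power_add) (simp add: mult_2 add_ac)
    moreover have "(- 1 / q ^ n) ^ n * (q ^ n) ^ n = (- 1) ^ n"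
      using q_nonzero by (simp flip: power_mult_distrib)
    ultimately have power: "(- 1 / q ^ n) ^ n * q ^ n * (q ^ (n choose 2) * q ^ (n choose 2)) = (- 1) ^ n"
      by (simp add: mult.assoc)
    have "(qpoch q (1 / q ^ N) n * qpoch q q (N - n)) * (qpoch q (1 / q ^ n) n * q ^ n) =
        ((- 1 / q ^ N) ^ n * qpoch q q N * qpoch q q n) *
        ((- 1 / q ^ n) ^ n * q ^ n * (q ^ (n choose 2) * q ^ (n choose 2)))"
      unfolding qpoch_neg_power[OF nN] top by (simp only: mult_ac)
    also have "\<dots> = (1 / q ^ N) ^ n * qpoch q q N * qpoch q q n"
      unfolding power by (simp flip: power_mult_distrib)
    finally show ?thesis
      using qpoch_neg_power_nonzero[OF nN] qpoch_q_nonzero[of N] q_nonzero by (simp add: field_simps)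
  qed
  moreover have "qpoch q (c * q ^ n) n * qpoch q (c * q ^ (1 + 2 * n)) (N - n) / qpoch q (c * q) N =
      qpoch q (c * q ^ (N + 1)) n / qpoch q (c * q) n * ((1 - c * q ^ n) / (1 - c * q ^ (2 * n)))"
  proof -
    have cn: "qpoch q (c * q) n \<noteq> 0"
      using nz(1) nN by (rule qpoch_nonzero_mono)
    \<comment> \<open>The first factorial stops before \<open>c q^(2n)\<close> and the second starts
      after it; this gap is the source of the denominator \<open>1 - c q^(2n)\<close> in the
      norm.\<close>
    have glue: "qpoch q (c * q ^ n) n * (1 - c * q ^ (2 * n)) * qpoch q (c * q ^ (1 + 2 * n)) (N - n) =
        (1 - c * q ^ n) * qpoch q (c * q ^ n * q) N"
    proof -
      have "qpoch q (c * q ^ n) n * (1 - c * q ^ (2 * n)) * qpoch q (c * q ^ (1 + 2 * n)) (N - n) =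
          qpoch q (c * q ^ n) (Suc n + (N - n))"
        unfolding qpoch_add qpoch_Suc by (simp add: power_add mult_2 mult_2_right mult_ac)
      then show ?thesis
        using nN qpoch_Suc_left[of "c * q ^ n" N] by simp
    qed
    \<comment> \<open>Both sides are \<open>(c q)_(n+N)\<close>, split after \<open>n\<close> and
      after \<open>N\<close> factors.\<close>
    have swap: "qpoch q (c * q) n * qpoch q (c * q ^ n * q) N = qpoch q (c * q) N * qpoch q (c * q ^ (N + 1)) n"
      using qpoch_add[of "c * q" n N] qpoch_add[of "c * q" N n] by (simp add: add_ac mult_ac)
    have "qpoch q (c * q ^ n) n * (1 - c * q ^ (2 * n)) * qpoch q (c * q ^ (1 + 2 * n)) (N - n) * qpoch q (c * q) n =
        (1 - c * q ^ n) * (qpoch q (c * q) n * qpoch q (c * q ^ n * q) N)"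
      unfolding glue by simp
    then have "qpoch q (c * q ^ n) n * (1 - c * q ^ (2 * n)) * qpoch q (c * q ^ (1 + 2 * n)) (N - n) * qpoch q (c * q) n =
        (1 - c * q ^ n) * (qpoch q (c * q) N * qpoch q (c * q ^ (N + 1)) n)"
      unfolding swap .
    then show ?thesis
      using nz cn by (simp add: divide_simps mult_ac)
  qed
  ultimately have "qpoch q q (N - n) / qpoch q q N * (qpoch q (1 / q ^ n) n * q ^ n) *
      (qpoch q (c * q ^ n) n * qpoch q (c * q ^ (1 + 2 * n)) (N - n) / qpoch q (c * q) N) =
    (1 / q ^ N) ^ n * (qpoch q q n / qpoch q (1 / q ^ N) n) *
      (qpoch q (c * q ^ (N + 1)) n / qpoch q (c * q) n * ((1 - c * q ^ n) / (1 - c * q ^ (2 * n))))"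
    by (simp only:)
  then show ?thesis
    by (simp only: times_divide_eq_left times_divide_eq_right divide_divide_eq_left mult_ac)
qed

text \<open>The theorem after elimination of \<open>b\<close>, \<open>e\<close>,
  \<open>\<mu>\<close> and the nodes, with natural powers of \<open>q\<close> only. The sums over
  \<open>k\<close>, \<open>i\<close>, \<open>j\<close> are evaluated by \<open>basis_moment\<close>,
  \<open>numerator_moment\<close> and \<open>biorthogonality_sum\<close>.\<close>

lemma biorthogonality:
  assumes a: "a = c * p" and nz: "c \<noteq> 0" "p \<noteq> 0" "d \<noteq> 0" and E: "E * d * q ^ N = p * q"
    and nz': "qpoch q (a * q) N \<noteq> 0" "qpoch q E N \<noteq> 0" "qpoch q p N \<noteq> 0" "qpoch q d N \<noteq> 0"
      "qpoch q (a * q / d) N \<noteq> 0" "qpoch q (c * q) N \<noteq> 0" "1 - c * q ^ (2 * n) \<noteq> 0"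
      "qpoch q (p * q / q ^ n) n \<noteq> 0"
      "\<And>k. k \<le> N \<Longrightarrow> qpoch q (d / (a * q ^ k * q ^ n)) n \<noteq> 0"
      "\<And>k. k \<le> N \<Longrightarrow> qpoch q (a * q * q ^ k) n \<noteq> 0"
    and nm: "n \<le> N" "m \<le> N"
  shows "(\<Sum>k\<le>N.
      qpoch q (a * q) n * qpoch q (a * q * q ^ k / d) n /
      (qpoch q (a * q / d) n * qpoch q (a * q * q ^ k) n) *
      (\<Sum>i\<le>n. qpoch q d i * qpoch q (1 / (c * q ^ N * q ^ n)) i * qpoch q (1 / q ^ k) i * qpoch q (1 / q ^ n) i /
        (qpoch q (1 / q ^ N) i * qpoch q (p * q / q ^ n) i * qpoch q (d / (a * q ^ k * q ^ n)) i * qpoch q q i) * q ^ i) *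
      (\<Sum>j\<le>m. qpoch q (1 / q ^ k) j * qpoch q (q / (d * q ^ N)) j * qpoch q (c * q ^ m) j * qpoch q (1 / q ^ m) j /
        (qpoch q (q / (p * q ^ k)) j * qpoch q (a * q / d) j * qpoch q (1 / q ^ N) j * qpoch q q j) * q ^ j) *
      (qpoch q (a * q / d) k * qpoch q (1 / q ^ N) k * qpoch q p k /
        (qpoch q (a * q) k * qpoch q E k * qpoch q q k) * q ^ k *
        ((d / (a * q)) ^ N * (qpoch q (a * q) N * qpoch q E N / (qpoch q d N * qpoch q (1 / (c * q ^ N)) N))))) =
    (1 / (d * q ^ N)) ^ n *
      (qpoch q q n * qpoch q (d / p) n * qpoch q (c * q ^ (N + 1)) n * qpoch q (a * q) n /
        (qpoch q (1 / q ^ N) n * qpoch q (1 / p) n * qpoch q (a * q / d) n * qpoch q (c * q) n)) *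
      ((1 - c * q ^ n) / (1 - c * q ^ (2 * n))) * (if n = m then 1 else 0)"
    (is "(\<Sum>k\<le>N. ?U k * ?V k * (?w k * ?K)) = ?C * _")
proof -
  \<comment> \<open>\<open>\<kappa>\<close> and \<open>u\<close> expand the numerator function in
    the \<open>\<psi>\<close> basis, \<open>v\<close> expands its partner in the
    \<open>\<phi>\<close> basis. Row \<open>j\<close> will sum to \<open>Z * s j\<close>, where
    \<open>Z\<close> collects what does not depend on \<open>j\<close>.\<close>
  define \<kappa> where "\<kappa> = qpoch q (a * q) n * qpoch q (d / p) n / (qpoch q (a * q / d) n * qpoch q (1 / p) n * d ^ n)"
  define u where "u i = qpoch q (1 / q ^ n) i * qpoch q d i * qpoch q (c * q ^ n) i /
        (qpoch q q i * qpoch q (1 / q ^ N) i * qpoch q (d / p) i) * q ^ i" for i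
  define v where "v j = qpoch q (q / (d * q ^ N)) j * qpoch q (c * q ^ m) j * qpoch q (1 / q ^ m) j /
        (qpoch q (a * q / d) j * qpoch q (1 / q ^ N) j * qpoch q q j) * q ^ j" for j
  define \<phi> where "\<phi> j k = qpoch q (1 / q ^ k) j / qpoch q (q / (p * q ^ k)) j" for j k
  define \<psi> where "\<psi> i k = qpoch q (q ^ k / q ^ N) i / qpoch q (a * q * q ^ k) i" for i k
  define Z where "Z = qpoch q d N * qpoch q q (N - n) / (qpoch q (a * q) N * qpoch q (d / p) N * qpoch q q N)"
  define s where "s j = qpoch q (c * q ^ m) j * qpoch q (1 / q ^ m) j * q ^ j *
      (if j < n then 0 else qpoch q (c * q ^ (1 + j) * q ^ n) (N - j) / qpoch q q (j - n))" for j
  have a0: "a \<noteq> 0"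
    using a nz by simp
  have Edp: "E * (d / p) * q ^ N = q"
    using E nz by (simp add: field_simps)
  then have dpN: "qpoch q (d / p) N \<noteq> 0"
    using qpoch_reverse_nonzero_iff nz'(2) by blast
  have dpn: "qpoch q (d / p) n \<noteq> 0"
    using dpN nm(1) by (rule qpoch_nonzero_mono)
  have U: "?U k = \<kappa> * (\<Sum>i\<le>n. u i * \<psi> i k)" if "k \<le> N" for k
    unfolding \<kappa>_def u_def \<psi>_def
    by (rule biorthogonal_numerator_expansion[OF a nz nm(1) nz'(8) nz'(9)[OF that] nz'(10)[OF that] dpn])
  have V: "?V k = (\<Sum>j\<le>m. v j * \<phi> j k)" for k
    unfolding v_def \<phi>_def by (simp add: mult_ac)
  have row: "v j * (\<Sum>i\<le>n. u i * (\<Sum>k\<le>N. ?w k * \<phi> j k * \<psi> i k)) = Z * s j" if "j \<le> m" for j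
  proof -
    have j: "j \<le> N"
      using that nm by simp
    \<comment> \<open>In length \<open>N\<close>, \<open>y\<close> is reflected to \<open>d\<close>
      and \<open>E = p * y\<close> to \<open>d / p\<close>. Hence \<open>qpoch_diff\<close> yields
      the same factor \<open>P\<close> in both products, and \<open>ratio\<close> is free of
      \<open>j\<close>.\<close>
    define y where "y = q / (d * q ^ N)"
    have y: "d * y * q ^ N = q" "E = p * y"
      using nz q_nonzero E by (simp_all add: y_def field_simps)
    have y0: "y \<noteq> 0"
      using nz q_nonzero by (simp add: y_def)
    define P where "P = (- y) ^ j * q ^ (j choose 2)"
    have P0: "P \<noteq> 0"
      using y0 q_nonzero by (simp add: P_def)
    have "(- E) ^ j = p ^ j * (- y) ^ j"
      by (simp add: y(2) flip: power_mult_distrib)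
    then have diffs: "qpoch q y j * qpoch q d (N - j) = P * qpoch q d N"
      "qpoch q E j * qpoch q (d / p) (N - j) = p ^ j * P * qpoch q (d / p) N"
      using qpoch_diff[OF y(1) j] qpoch_diff[of "d / p" E N j] Edp j by (simp_all add: P_def mult_ac)
    have ratio: "qpoch q y j * (p ^ j * qpoch q d (N - j) / (qpoch q E j * qpoch q (d / p) (N - j))) =
        qpoch q d N / qpoch q (d / p) N"
    proof -
      have "qpoch q y j * (p ^ j * qpoch q d (N - j) / (qpoch q E j * qpoch q (d / p) (N - j))) =
        p ^ j * (qpoch q y j * qpoch q d (N - j)) / (qpoch q E j * qpoch q (d / p) (N - j))"
        by simp
      then show ?thesis
        unfolding diffs using P0 nz by simp
    qed
    have nzj: "qpoch q (a * q / d) j \<noteq> 0" "qpoch q (1 / q ^ N) j \<noteq> 0"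
      using qpoch_nonzero_mono[OF nz'(5) j] qpoch_neg_power_nonzero[OF j] .
    have "(\<Sum>i\<le>n. u i * (\<Sum>k\<le>N. ?w k * \<phi> j k * \<psi> i k)) = p ^ j * qpoch q (a * q / d) j * qpoch q d (N - j) * qpoch q (1 / q ^ N) j /
        (qpoch q E j * qpoch q (a * q) N * qpoch q (d / p) (N - j)) *
      (if j < n then 0 else qpoch q (c * q ^ (1 + j) * q ^ n) (N - j) *
        (qpoch q q (N - n) * qpoch q q j / (qpoch q q (j - n) * qpoch q q N)))"
      unfolding numerator_moment[OF a nz(1,2) dpN nm(1) j, symmetric] u_def \<phi>_def \<psi>_def
    proof (rule sum.cong[OF refl], goal_cases)
      case (1 i)
      then have "i \<le> N"
        using nm by simp
      then show ?case
        by (subst basis_moment[OF a0 nz(3,2) E nz'(1-3) _ j]) simp_all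
    qed
    then have "v j * (\<Sum>i\<le>n. u i * (\<Sum>k\<le>N. ?w k * \<phi> j k * \<psi> i k)) =
      qpoch q y j * (p ^ j * qpoch q d (N - j) / (qpoch q E j * qpoch q (d / p) (N - j))) *
      (qpoch q q (N - n) / (qpoch q (a * q) N * qpoch q q N)) * s j"
      using nzj qpoch_q_nonzero[of j] by (simp add: v_def s_def y_def mult_ac)
    then show ?thesis
      unfolding ratio by (simp add: Z_def mult_ac)
  qed
  have "(\<Sum>k\<le>N. ?U k * ?V k * (?w k * ?K)) =
      (\<Sum>k\<le>N. \<kappa> * ?K * (\<Sum>j\<le>m. \<Sum>i\<le>n. v j * u i * (?w k * \<phi> j k * \<psi> i k)))"
  proof (rule sum.cong[OF refl])
    fix k assume "k \<in> {..N}"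
    then have k: "k \<le> N" by simp
    have "(\<Sum>j\<le>m. \<Sum>i\<le>n. v j * u i * (?w k * \<phi> j k * \<psi> i k)) =
        ?w k * ((\<Sum>j\<le>m. v j * \<phi> j k) * (\<Sum>i\<le>n. u i * \<psi> i k))"
      unfolding sum_product unfolding sum_distrib_left by (intro sum.cong refl) (simp only: mult_ac)
    then show "?U k * ?V k * (?w k * ?K) = \<kappa> * ?K * (\<Sum>j\<le>m. \<Sum>i\<le>n. v j * u i * (?w k * \<phi> j k * \<psi> i k))"
      unfolding U[OF k] V by (simp only: mult_ac)
  qed
  also have "\<dots> = \<kappa> * ?K * (\<Sum>j\<le>m. v j * (\<Sum>i\<le>n. u i * (\<Sum>k\<le>N. ?w k * \<phi> j k * \<psi> i k)))"
    unfolding sum_distrib_left[symmetric] sum.swap[of _ _ "{..N}"]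
    unfolding sum_distrib_left mult.assoc ..
  also have "(\<Sum>j\<le>m. v j * (\<Sum>i\<le>n. u i * (\<Sum>k\<le>N. ?w k * \<phi> j k * \<psi> i k))) = (\<Sum>j\<le>m. Z * s j)"
    by (rule sum.cong) (simp_all only: row atMost_iff)
  also have "\<dots> = Z * (if n = m then qpoch q (c * q ^ n) n * qpoch q (1 / q ^ n) n * q ^ n *
       qpoch q (c * q ^ (1 + 2 * n)) (N - n) else 0)"
    unfolding sum_distrib_left[symmetric] s_def biorthogonality_sum[OF nz(1) nm] ..
  also have "\<kappa> * ?K * \<dots> = \<kappa> * (if n = m then (?K * Z) * (qpoch q (c * q ^ n) n * qpoch q (1 / q ^ n) n * q ^ n *
       qpoch q (c * q ^ (1 + 2 * n)) (N - n)) else 0)"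
    by (simp add: mult_ac)
  \<comment> \<open>Reversal turns \<open>(E)_N\<close> and \<open>(1 / (c q^N))_N\<close> into
    \<open>(d / p)_N\<close> and \<open>(c q)_N\<close>; the power \<open>(d / (a * q)) ^ N\<close>
    in the weight makes the resulting powers cancel.\<close>
  also have "?K * Z = qpoch q q (N - n) / (qpoch q (c * q) N * qpoch q q N)"
  proof -
    have rE: "qpoch q E N = (- E) ^ N * q ^ (N choose 2) * qpoch q (d / p) N"
      using Edp by (rule qpoch_reverse)
    have rl: "qpoch q (1 / (c * q ^ N)) N = (- (1 / (c * q ^ N))) ^ N * q ^ (N choose 2) * qpoch q (c * q) N"
      by (rule qpoch_reverse) (use nz q_nonzero in simp)
    have "d / (a * q) * - E = - (1 / (c * q ^ N))"
      using E nz q_nonzero by (simp add: a field_simps)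
    then have pw: "(d / (a * q)) ^ N * (- E) ^ N = (- (1 / (c * q ^ N))) ^ N"
      by (metis power_mult_distrib)
    have "(d / (a * q)) ^ N * qpoch q E N * qpoch q (c * q) N = qpoch q (1 / (c * q ^ N)) N * qpoch q (d / p) N"
      unfolding rE rl pw[symmetric] by simp
    moreover have "qpoch q (1 / (c * q ^ N)) N \<noteq> 0"
      unfolding rl using nz nz'(6) q_nonzero by simp
    ultimately have "(d / (a * q)) ^ N * qpoch q E N / (qpoch q (1 / (c * q ^ N)) N * qpoch q (d / p) N) = 1 / qpoch q (c * q) N"
      using dpN nz'(6) a0 q_nonzero by (simp add: field_simps)
    moreover have "?K * Z = (d / (a * q)) ^ N * qpoch q E N / (qpoch q (1 / (c * q ^ N)) N * qpoch q (d / p) N) *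
        (qpoch q q (N - n) / qpoch q q N)"
      using nz'(1,4) by (simp add: Z_def mult_ac)
    ultimately show ?thesis
      by simp
  qed
  also note biorthogonality_constant[OF nm(1) nz'(6,7)]
  also have "\<kappa> * (if n = m then (1 / q ^ N) ^ n * (qpoch q q n * qpoch q (c * q ^ (N + 1)) n / (qpoch q (1 / q ^ N) n * qpoch q (c * q) n)) *
      ((1 - c * q ^ n) / (1 - c * q ^ (2 * n))) else 0) = ?C * (if n = m then 1 else 0)"
    by (simp add: \<kappa>_def power_divide power_mult_distrib mult_ac)
  finally show ?thesis .
qed

end

section \<open>Translation from the original parameters\<close>

theorem corollary4p5:
  fixes q a b d e \<mu> :: complex and N n m :: nat
  assumes "0 < cmod q" and "cmod q < 1"
    and "a \<noteq> 0" and "b \<noteq> 0" and "d \<noteq> 0" and "e \<noteq> 0" and "\<mu> \<noteq> 0"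
    and "no_zero_denominators q a b d e \<mu> N"
    and "n \<le> N" and "m \<le> N"
  shows "(\<Sum>k\<le>N. U_fun q a b d e \<mu> N n (x_pt q b k) * V_fun q a b d e \<mu> N m (x_pt q b k) *
                 r_wt q a b d e \<mu> N k) =
         C_norm q a b d e \<mu> N n * (if n = m then 1 else 0)"
proof -
  have q0: "q \<noteq> 0"
    using assms(1) by auto
  have qroot: "q ^ k \<noteq> 1" if "0 < k" for k
  proof -
    have "cmod (q ^ k) < 1"
      using assms(1,2) that by (simp add: norm_power power_less_one_iff)
    then show ?thesis
      by auto
  qed
  \<comment> \<open>\<open>p\<close> is the last upper parameter of the weight and \<open>E\<close>
    its second lower one; \<open>c\<close> equals \<open>a^2 q^(1-N) / (\<mu> b^2 d e)\<close>, so
    that \<open>c q^m\<close> is an upper parameter of \<open>V_fun\<close>.\<close>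
  define p where "p = b\<^sup>2 * \<mu> * d * e * q ^ N / (a * q)"
  define c where "c = a / p"
  define E where "E = \<mu> * b\<^sup>2 * e / a"
  have p0: "p \<noteq> 0"
    using assms q0 by (simp add: p_def)
  have c0: "c \<noteq> 0"
    using assms p0 by (simp add: c_def)
  have acp: "a = c * p"
    using p0 by (simp add: c_def)
  have Edq: "E * d * q ^ N = p * q"
    using assms q0 by (simp add: E_def p_def field_simps)
  note nz = assms(3-7) q0
  have U_args: "2 * a * q * x_pt q b k / (b * d) = a * q * q ^ k / d"
    "2 * a * q * x_pt q b k / b = a * q * q ^ k"
    "b\<^sup>2 * \<mu> * d * e / (a\<^sup>2 * q) * q powi (- int n) = 1 / (c * q ^ N * q ^ n)"
    "b / (2 * x_pt q b k) = 1 / q ^ k"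
    "b\<^sup>2 * \<mu> * d * e / a * q powi (int N - int n) = p * q / q ^ n"
    "b * d / (2 * a * x_pt q b k) * q powi (- int n) = d / (a * q ^ k * q ^ n)" for k n
    using nz by (simp_all add: x_pt_def c_def p_def power_int_diff power_int_minus field_simps power2_eq_square)
  have V_args: "q powi (- int N + 1) / d = q / (d * q ^ N)"
    "a\<^sup>2 * q powi (1 - int N + int m) / (b\<^sup>2 * \<mu> * d * e) = c * q ^ m"
    "a * q powi (- int N + 2) / (2 * \<mu> * b * d * e * x_pt q b k) = q / (p * q ^ k)" for k m
    using nz by (simp_all add: x_pt_def c_def p_def power_int_add power_int_diff power_int_minus field_simps power2_eq_square)
  have neg: "q powi (- int k) = 1 / q ^ k" for k
    by (simp add: power_int_minus inverse_eq_divide)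
  have r_args: "\<mu> * b\<^sup>2 * d * e / (a * q) * q ^ N = p" "\<mu> * b\<^sup>2 * e / a = E"
    "\<mu> * b\<^sup>2 * d * e / (a\<^sup>2 * q) = 1 / (c * q ^ N)"
    using nz by (simp_all add: c_def p_def E_def field_simps power2_eq_square)
  have C_args: "a * q powi (1 - int N) / (\<mu> * b\<^sup>2 * e) = d / p"
    "a\<^sup>2 * q\<^sup>2 / (\<mu> * b\<^sup>2 * d * e) = c * q ^ (N + 1)"
    "a * q powi (1 - int N) / (\<mu> * b\<^sup>2 * d * e) = 1 / p"
    "a\<^sup>2 * q powi (2 - int N) / (\<mu> * b\<^sup>2 * d * e) = c * q"
    "a\<^sup>2 * q powi (1 - int N + int n) / (\<mu> * b\<^sup>2 * d * e) = c * q ^ n"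
    "a\<^sup>2 * q powi (1 - int N + 2 * int n) / (\<mu> * b\<^sup>2 * d * e) = c * q ^ (2 * n)"
    "q powi (- int N) / d = 1 / (d * q ^ N)" for n
  proof -
    have "q powi (2 * int n) = q ^ (2 * n)"
      by (metis of_nat_mult of_nat_numeral power_int_of_nat)
    then show "a\<^sup>2 * q powi (1 - int N + 2 * int n) / (\<mu> * b\<^sup>2 * d * e) = c * q ^ (2 * n)"
      using nz by (simp add: c_def p_def power_int_add power_int_diff field_simps power2_eq_square)
  qed (use nz in \<open>simp_all add: c_def p_def power_int_add power_int_diff power_int_minus field_simps power2_eq_square\<close>)
  \<comment> \<open>\<open>neg\<close> must come last: some left-hand sides of \<open>U_args\<close>
    and \<open>C_args\<close> contain the negative powers that it rewrites.\<close>
  note nzd = assms(8)[unfolded no_zero_denominators_def phi43_defined_def,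
      unfolded U_args V_args r_args C_args, unfolded neg]
  have nzN: "qpoch q (a * q) N \<noteq> 0" "qpoch q E N \<noteq> 0" "qpoch q d N \<noteq> 0"
      "qpoch q (a * q / d) N \<noteq> 0" "qpoch q (c * q) N \<noteq> 0" "1 - c * q ^ (2 * n) \<noteq> 0"
    using nzd assms(9) by (auto simp: qpochs_def)
  have nzU: "qpoch q (p * q / q ^ n) n \<noteq> 0" "qpoch q (d / (a * q ^ k * q ^ n)) n \<noteq> 0"
    "qpoch q (a * q * q ^ k) n \<noteq> 0" if "k \<le> N" for k
    using nzd assms(9) that by (auto simp: qpochs_def)
  \<comment> \<open>This is the first lower factorial of \<open>V_fun\<close> with degree and index
    \<open>N\<close> at the node with \<open>k = N\<close>; its reflection is
    \<open>p\<close>.\<close>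
  have "qpoch q (q / (p * q ^ N)) N \<noteq> 0"
    using nzd by (auto simp: qpochs_def)
  moreover have "p * (q / (p * q ^ N)) * q ^ N = q"
    using p0 q0 by simp
  ultimately have pN: "qpoch q p N \<noteq> 0"
    using qpoch_reverse_nonzero_iff[OF q0 qroot] by blast
  have U: "U_fun q a b d e \<mu> N n (x_pt q b k) =
      qpoch q (a * q) n * qpoch q (a * q * q ^ k / d) n /
      (qpoch q (a * q / d) n * qpoch q (a * q * q ^ k) n) *
      (\<Sum>i\<le>n. qpoch q d i * qpoch q (1 / (c * q ^ N * q ^ n)) i * qpoch q (1 / q ^ k) i * qpoch q (1 / q ^ n) i /
        (qpoch q (1 / q ^ N) i * qpoch q (p * q / q ^ n) i * qpoch q (d / (a * q ^ k * q ^ n)) i * qpoch q q i) * q ^ i)" for k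
    unfolding U_fun_def phi43_def unfolding U_args unfolding neg by (simp add: qpochs_def mult_ac)
  have V: "V_fun q a b d e \<mu> N m (x_pt q b k) =
      (\<Sum>j\<le>m. qpoch q (1 / q ^ k) j * qpoch q (q / (d * q ^ N)) j * qpoch q (c * q ^ m) j * qpoch q (1 / q ^ m) j /
        (qpoch q (q / (p * q ^ k)) j * qpoch q (a * q / d) j * qpoch q (1 / q ^ N) j * qpoch q q j) * q ^ j)" for k
    unfolding V_fun_def phi43_def unfolding U_args V_args unfolding neg by (simp add: qpochs_def mult_ac)
  have r: "r_wt q a b d e \<mu> N k =
      qpoch q (a * q / d) k * qpoch q (1 / q ^ N) k * qpoch q p k /
        (qpoch q (a * q) k * qpoch q E k * qpoch q q k) * q ^ k *
        ((d / (a * q)) ^ N * (qpoch q (a * q) N * qpoch q E N / (qpoch q d N * qpoch q (1 / (c * q ^ N)) N)))" for k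
    unfolding r_wt_def r_args neg by (simp add: qpochs_def mult_ac)
  have C: "C_norm q a b d e \<mu> N n = (1 / (d * q ^ N)) ^ n *
      (qpoch q q n * qpoch q (d / p) n * qpoch q (c * q ^ (N + 1)) n * qpoch q (a * q) n /
        (qpoch q (1 / q ^ N) n * qpoch q (1 / p) n * qpoch q (a * q / d) n * qpoch q (c * q) n)) *
      ((1 - c * q ^ n) / (1 - c * q ^ (2 * n)))"
    unfolding C_norm_def C_args unfolding neg by (simp add: qpochs_def mult_ac)
  show ?thesis
    unfolding U V r C
    \<comment> \<open>The fact \<open>nzU(1)\<close> does not involve \<open>k\<close>, so its
      premise is discharged at 0.\<close>
    by (rule biorthogonality[OF q0 qroot acp c0 p0 assms(5) Edq nzN(1,2) pN nzN(3-6) nzU(1)[OF le0] nzU(2,3) assms(9,10)])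
qed

end
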